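(* Let $T>0$ and let $\phi:\mathbb{R}\to\mathbb{R}$ be $C^2$ with $\sup_{x\in\mathbb{R}}|\phi''(x)|<+\infty$ and $\phi(x)\ge c_0(1+|x|^2)$ for all $x\in\mathbb{R}$, for some $c_0>0$. For any $r>0$ and $N\in\mathbb{N}$, given $\mathbf{X}^0=(x_1^0,\dots,x_N^0)\in\mathbb{R}^N$ such that $x_{i+1}^0-x_i^0\ge 2r$ for all $i=1,\dots,N-1$, there exist unique $\mathbf{X}(t)=(x_1(t),\dots,x_N(t))\in H^1(0,T;\mathbb{R}^N)$ and $\mathbf{\Lambda}(t)=(\lambda_0(t),\lambda_1(t),\dots,\lambda_N(t))\in L^2(0,T;\mathbb{R}^{N+1})$ with $x_i(0)=x_i^0$ for $i=1,\dots,N$ such that $$\dot x_i(t)=-\phi'(x_i(t))-N(\lambda_i(t)-\lambda_{i-1}(t)),\qquad i=1,\dots,N,$$ $$x_{i+1}(t)-x_i(t)\ge 2r,\qquad \lambda_i(t)\ge 0,\qquad \lambda_i(t)\,(x_{i+1}(t)-x_i(t)-2r)=0,\qquad i=1,\dots,N-1,$$ $$\lambda_0(t)=\lambda_N(t)=0.$$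
   Context: The relations involving $\dot x_i$ or $\lambda_i$ are understood for a.e. $t\in[0,T]$; the non-overlapping condition holds for all $t\in[0,T]$ (with the continuous representative of $\mathbf{X}$). *)

theory Defs
  imports "HOL-Analysis.Analysis"
begin

text \<open>
  A function with values in \<open>\<real>\<^sup>I\<close>, for a finite set \<open>I\<close> of indices, is rendered as a map
  \<open>real \<Rightarrow> nat \<Rightarrow> real\<close> of which only the components in \<open>I\<close> are considered.
  Elements of \<open>L\<^sup>2\<close> and \<open>H\<^sup>1\<close> are represented by functions, not by classes modulo null sets.
\<close>

definition L2 :: "real \<Rightarrow> (real \<Rightarrow> real) set" where
  "L2 T = {u. u \<in> borel_measurable (lebesgue_on {0<..<T}) \<and>
              integrable (lebesgue_on {0<..<T}) (\<lambda>t. (u t)\<^sup>2)}"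

definition test_function :: "real \<Rightarrow> (real \<Rightarrow> real) \<Rightarrow> bool" where
  "test_function T \<eta> \<longleftrightarrow>
     \<eta> C1_differentiable_on UNIV \<and>
     compact (closure {t. \<eta> t \<noteq> 0}) \<and> closure {t. \<eta> t \<noteq> 0} \<subseteq> {0<..<T}"

text \<open>
  The distributional derivative, tested against \<open>C\<^sup>1\<close> functions with compact support in
  \<open>(0,T)\<close>, as is customary on intervals.  Requiring both functions to be in \<open>L\<^sup>2\<close> ensures
  that the two integrands are integrable.
\<close>

definition has_weak_deriv :: "real \<Rightarrow> (real \<Rightarrow> real) \<Rightarrow> (real \<Rightarrow> real) \<Rightarrow> bool" where
  "has_weak_deriv T u v \<longleftrightarrow>
     u \<in> L2 T \<and> v \<in> L2 T \<and>
     (\<forall>\<eta>. test_function T \<eta> \<longrightarrow>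
        (LINT t|lebesgue_on {0<..<T}. u t * deriv \<eta> t) =
        - (LINT t|lebesgue_on {0<..<T}. v t * \<eta> t))"

definition H1 :: "real \<Rightarrow> (real \<Rightarrow> real) set" where
  "H1 T = {u. \<exists>v. has_weak_deriv T u v}"

definition L2_vec :: "real \<Rightarrow> nat set \<Rightarrow> (real \<Rightarrow> nat \<Rightarrow> real) set" where
  "L2_vec T I = {U. \<forall>i\<in>I. (\<lambda>t. U t i) \<in> L2 T}"

definition H1_vec :: "real \<Rightarrow> nat set \<Rightarrow> (real \<Rightarrow> nat \<Rightarrow> real) set" where
  "H1_vec T I = {U. \<forall>i\<in>I. (\<lambda>t. U t i) \<in> H1 T}"

text \<open>
  \<open>X\<close> is required to be the continuous representative of its class, which gives a meaning to
  the initial condition and to the non-overlapping condition at every time.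
  The weak derivative \<open>v\<close> of a component is determined up to a null set.
\<close>

definition is_solution ::
  "real \<Rightarrow> (real \<Rightarrow> real) \<Rightarrow> real \<Rightarrow> nat \<Rightarrow> (nat \<Rightarrow> real) \<Rightarrow>
   (real \<Rightarrow> nat \<Rightarrow> real) \<Rightarrow> (real \<Rightarrow> nat \<Rightarrow> real) \<Rightarrow> bool" where
  "is_solution T \<phi> r N x0 X \<Lambda> \<longleftrightarrow>
     X \<in> H1_vec T {1..N} \<and> (\<forall>i\<in>{1..N}. continuous_on {0..T} (\<lambda>t. X t i)) \<and>
     \<Lambda> \<in> L2_vec T {0..N} \<and>
     (\<forall>i\<in>{1..N}. X 0 i = x0 i) \<and>
     (\<forall>i\<in>{1..N}. \<exists>v. has_weak_deriv T (\<lambda>t. X t i) v \<and>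
        (AE t in lebesgue_on {0..T}.
           v t = - deriv \<phi> (X t i) - real N * (\<Lambda> t i - \<Lambda> t (i - 1)))) \<and>
     (\<forall>i\<in>{1..<N}. \<forall>t\<in>{0..T}. X t (i + 1) - X t i \<ge> 2 * r) \<and>
     (\<forall>i\<in>{1..<N}. AE t in lebesgue_on {0..T}.
        \<Lambda> t i \<ge> 0 \<and> \<Lambda> t i * (X t (i + 1) - X t i - 2 * r) = 0) \<and>
     (AE t in lebesgue_on {0..T}. \<Lambda> t 0 = 0 \<and> \<Lambda> t N = 0)"

end

theory Submission
  imports Defs
begin

text \<open>
  Let \<open>L\<^sub>i\<close> be the time integral of \<open>N \<lambda>\<^sub>i\<close>, and let \<open>z\<^sub>i\<close> be \<open>x\<^sub>i\<^sup>0\<close> minus the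
  time integral of \<open>\<phi>' (x\<^sub>i)\<close>, so that \<open>x\<^sub>i = z\<^sub>i - L\<^sub>i + L\<^sub>i\<^sub>-\<^sub>1\<close>.  The complementarity conditions
  form a Skorokhod reflection problem for the gaps: \<open>L\<^sub>i\<close> is the running maximum of the positive part of
  \<open>f\<^sub>i = (z\<^sub>i - z\<^sub>i\<^sub>+\<^sub>1 + 2 r + L\<^sub>i\<^sub>-\<^sub>1 + L\<^sub>i\<^sub>+\<^sub>1) / 2\<close>, and the free gap is \<open>2 (L\<^sub>i - f\<^sub>i)\<close>.  Together with the
  integral equation for \<open>z\<close> this is a fixed point equation, and it is a contraction in a sup norm with a concave
  weight in \<open>i\<close> and an exponential weight in \<open>t\<close>.  A discrete maximum principle shows that the fixed point
  \<open>L\<close> is Lipschitz in time, so the Radon--Nikodym theorem provides \<open>\<lambda>\<close>.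

  Uniqueness is an energy estimate: the reaction forces of two solutions are monotone, and Gronwall's
  lemma applies to the squared distance.  The multipliers are then determined successively, starting from
  \<open>\<lambda>\<^sub>0 = 0\<close>, by the uniqueness of weak derivatives.
\<close>

section \<open>Primitives and densities\<close>

text \<open>The integrals \<open>L\<close> of the multipliers are continuous, so a sup norm is
  available for them. The obstacle is the coupling of neighbouring gaps: the average
  \<open>(L (i - 1) + L (i + 1)) / 2\<close> can have norm 1 in the plain sup norm, and since no
  time integral is involved, short time intervals do not help. The zero boundary values must be
  exploited: averaging lowers the weight by 1, of which one half is spent on the positions
  \<open>z\<close> and the other half is the contraction margin. The equation for \<open>z\<close>
  does contain a time integral, and there the exponential weight supplies an arbitrarily small
  factor. The fixed point is a priori only continuous in time; by compactness this bounds the force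
  along it, so \<open>z\<close> is Lipschitz, and the maximum principle passes this on to
  \<open>L\<close>. For uniqueness, positions have only weak derivatives. A du Bois-Reymond argument
  identifies them with primitives, and the chain rule for squares becomes an integration by parts
  that rests on Fubini alone.\<close>

lemma AE_zero_if_integrals_atMost_zero:
  fixes w :: "real \<Rightarrow> real"
  assumes S: "S \<in> sets lebesgue" and w: "integrable (lebesgue_on S) w"
    and zero: "\<And>t. (LINT s|lebesgue_on S. indicator {..t} s * w s) = 0"
  shows "AE s in lebesgue_on S. w s = 0"
proof -
  define M where "M = lebesgue_on S"
  have sb: "A \<inter> S \<in> sets M" if "A \<in> sets lebesgue" for A
    using that S by (auto simp: M_def sets_restrict_space)
  have wM: "integrable M w" using w by (simp add: M_def)
  have int: "integrable M (\<lambda>s. indicator A s * w s)" if "A \<in> sets lebesgue" for A :: "real set"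
  proof -
    have "integrable M (\<lambda>s. indicator (A \<inter> S) s *\<^sub>R w s)"
      by (rule integrable_mult_indicator[OF sb[OF that] wM])
    moreover have "integrable M (\<lambda>s. indicator (A \<inter> S) s *\<^sub>R w s) \<longleftrightarrow> integrable M (\<lambda>s. indicator A s * w s)"
      by (rule Bochner_Integration.integrable_cong) (auto simp: M_def indicator_def)
    ultimately show ?thesis by simp
  qed
  define I where "I A = (LINT s|M. indicator A s * w s)" for A
  \<comment> \<open>Half-lines are closed under intersection and generate the Borel sets, so the
    vanishing spreads to all Borel sets by Dynkin's argument.\<close>
  have borelI: "I A = 0" if "A \<in> sigma_sets UNIV (range (\<lambda>t::real. {..t}))" for A
  proof -
    have st: "Int_stable (range (\<lambda>t::real. {..t}))" "range (\<lambda>t::real. {..t}) \<subseteq> Pow UNIV"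
      by (auto simp: Int_stable_def)
    from st that show ?thesis
    proof (induction A rule: sigma_sets_induct_disjoint)
      fix A assume "A \<in> range (\<lambda>t::real. {..t})" then show "I A = 0"
        using zero by (auto simp: I_def M_def)
    next
      show "I {} = 0" by (simp add: I_def)
      have sbor: "A \<in> sets lebesgue" if "A \<in> sigma_sets UNIV (range (\<lambda>t::real. {..t}))" for A
      proof -
        have "A \<in> sets borel" using that unfolding borel_eq_atMost by simp
        then show ?thesis by (simp)
      qed
      \<comment> \<open>Complements need the total integral, which is the limit of the integrals
        over growing half-lines and hence 0.\<close>
      have "(\<lambda>n::nat. LINT s|M. indicator {..real n} s * w s) \<longlonglongrightarrow> (LINT s|M. w s)"
      proof (rule integral_dominated_convergence[where w="\<lambda>s. norm (w s)"])
        show "AE s in M. (\<lambda>n. indicator {..real n} s * w s) \<longlonglongrightarrow> w s"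
        proof (rule AE_I2)
          fix s
          obtain m where m: "s \<le> real m" using real_arch_simple by blast
          have "\<forall>\<^sub>F n in sequentially. indicator {..real n} s * w s = w s"
            using eventually_ge_at_top[of m] by eventually_elim (use m in \<open>auto simp: indicator_def\<close>)
          then show "(\<lambda>n. indicator {..real n} s * w s) \<longlonglongrightarrow> w s" by (rule tendsto_eventually)
        qed
        show "(\<lambda>s. indicator {..real n} s * w s) \<in> borel_measurable M" for n
          using int[of "{..real n}"] by (intro borel_measurable_integrable) auto
      qed (use wM in \<open>auto simp: indicator_def\<close>)
      then have tot: "(LINT s|M. w s) = 0"
        using zero by (simp add: M_def LIMSEQ_const_iff)
      fix A assume A: "A \<in> sigma_sets UNIV (range (\<lambda>t::real. {..t}))" and IA: "I A = 0"
      have "I (UNIV - A) = (LINT s|M. w s - indicator A s * w s)"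
        unfolding I_def by (rule Bochner_Integration.integral_cong) (auto simp: indicator_def)
      also have "\<dots> = 0"
        using IA tot int[OF sbor[OF A]] wM by (simp add: I_def)
      finally show "I (UNIV - A) = 0" .
    next
      fix A :: "nat \<Rightarrow> real set"
      assume disj: "disjoint_family A" and A: "range A \<subseteq> sigma_sets UNIV (range (\<lambda>t::real. {..t}))"
        and IA: "\<And>i. I (A i) = 0"
      have sbor: "A i \<in> sets lebesgue" for i
      proof -
        have "A i \<in> sets borel" using A unfolding borel_eq_atMost by auto
        then show ?thesis by (simp)
      qed
      have un: "(\<Union>i. A i) \<in> sets lebesgue" using sbor by auto
      have fin: "(\<lambda>s. indicator (\<Union>i<n. A i) s * w s) = (\<lambda>s. \<Sum>i<n. indicator (A i) s * w s)" for n
        by (auto simp: indicator_UN_disjoint[OF _ disjoint_family_on_mono[OF subset_UNIV disj]] sum_distrib_right)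
      have "(\<lambda>n. LINT s|M. indicator (\<Union>i<n. A i) s * w s) \<longlonglongrightarrow> (LINT s|M. indicator (\<Union>i. A i) s * w s)"
      proof (rule integral_dominated_convergence[where w="\<lambda>s. norm (w s)"])
        show "AE s in M. (\<lambda>n. indicator (\<Union>i<n. A i) s * w s) \<longlonglongrightarrow> indicator (\<Union>i. A i) s * w s"
          by (intro AE_I2 tendsto_mult_right LIMSEQ_indicator_UN)
        show "(\<lambda>s. indicator (\<Union>i<n. A i) s * w s) \<in> borel_measurable M" for n
          using int[of "\<Union>i<n. A i"] sbor by (intro borel_measurable_integrable) auto
        show "(\<lambda>s. indicator (\<Union>i. A i) s * w s) \<in> borel_measurable M"
          using int[OF un] by (intro borel_measurable_integrable)
      qed (use wM in \<open>auto simp: indicator_def\<close>)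
      moreover have "(LINT s|M. indicator (\<Union>i<n. A i) s * w s) = 0" for n
        unfolding fin by (subst Bochner_Integration.integral_sum[OF int[OF sbor]]) (use IA in \<open>simp add: I_def\<close>)
      ultimately show "I (\<Union>i. A i) = 0" by (simp add: I_def LIMSEQ_const_iff)
    qed
  qed
  have "AE s in M. w s = 0"
  proof (rule density_unique_real[OF wM])
    show "integrable M (\<lambda>s. 0)" by simp
    fix A assume "A \<in> sets M"
    then obtain B where B: "B \<in> sets lebesgue" "A = S \<inter> B" by (auto simp: M_def sets_restrict_space)
    \<comment> \<open>A Lebesgue set is a Borel set up to a null set, so the Borel case covers every
      set that \<open>density_unique_real\<close> asks for.\<close>
    obtain N C N' where C: "B = C \<union> N" "N \<subseteq> N'" "N' \<in> null_sets lborel" "C \<in> sets lborel"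
      using B(1) by (auto elim: sets_completionE)
    have "AE s in lebesgue. s \<notin> N'" 
      using C(3) null_sets_completionI AE_not_in by blast
    then have "AE s in M. s \<notin> N'" unfolding M_def using S by (auto simp: AE_restrict_space_iff elim!: eventually_mono)
    then have "AE s in M. indicator B s * w s = indicator C s * w s"
      by eventually_elim (use C in \<open>auto simp: indicator_def\<close>)
    moreover have "C \<in> sets lebesgue" using C(4) by simp
    ultimately have "(LINT s|M. indicator B s * w s) = (LINT s|M. indicator C s * w s)"
      by (intro integral_cong_AE borel_measurable_integrable int B(1))
    moreover have "(LINT s|M. indicator A s *\<^sub>R w s) = (LINT s|M. indicator B s * w s)"
      by (rule Bochner_Integration.integral_cong) (auto simp: M_def B(2) indicator_def)
    ultimately have "(LINT s|M. indicator A s *\<^sub>R w s) = (LINT s|M. indicator C s * w s)" by simp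
    also have "\<dots> = 0"
      using borelI[of C] C(4) unfolding I_def borel_eq_atMost sets_lborel by simp
    finally show "(LINT s:A|M. w s) = (LINT s:A|M. 0)" by (simp add: set_lebesgue_integral_def)
  qed
  then show ?thesis unfolding M_def .
qed

text \<open>Fubini for \<open>f s * g t\<close> on the square, cut along the diagonal: one triangle
  gives \<open>F * g\<close>, the other \<open>f * G\<close>. Only integrability is required. It is
  used with \<open>g\<close> the derivative of a test function and with \<open>f = g\<close> for the
  energy identity.\<close>

lemma integral_by_parts_indefinite:
  fixes f g :: "real \<Rightarrow> real"
  assumes S: "S \<in> lmeasurable" and f: "integrable (lebesgue_on S) f" and g: "integrable (lebesgue_on S) g"
  defines "F \<equiv> \<lambda>t. LINT s|lebesgue_on S. indicator {..t} s * f s"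
    and "G \<equiv> \<lambda>t. LINT s|lebesgue_on S. indicator {..t} s * g s"
  shows "integrable (lebesgue_on S) (\<lambda>t. F t * g t)" "integrable (lebesgue_on S) (\<lambda>t. f t * G t)"
    "(LINT t|lebesgue_on S. F t * g t) + (LINT t|lebesgue_on S. f t * G t)
     = (LINT t|lebesgue_on S. f t) * (LINT t|lebesgue_on S. g t)"
proof -
  define M where "M = lebesgue_on S"
  interpret finite_measure M unfolding M_def by (rule finite_measure_lebesgue_on[OF S])
  interpret P: pair_sigma_finite M M ..
  have f[measurable]: "integrable M f" and g[measurable]: "integrable M g" using f g by (simp_all add: M_def)
  have idm[measurable]: "(\<lambda>x. x) \<in> borel_measurable M"
    unfolding M_def by (intro measurable_restrict_space1) (simp add: measurable_completion)
  have fg: "integrable (M \<Otimes>\<^sub>M M) (\<lambda>(s,t). f s * g t)"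
  proof (rule P.Fubini_integrable)
    show "integrable M (\<lambda>x. LINT y|M. norm (case (x, y) of (s, t) \<Rightarrow> f s * g t))"
      using f g by (simp add: abs_mult)
  qed (use f g in auto)
  have ind: "integrable (M \<Otimes>\<^sub>M M) (\<lambda>(s,t). of_bool (s \<le> t) * (f s * g t))"
    by (rule Bochner_Integration.integrable_bound[OF fg]) auto
  have ind': "integrable (M \<Otimes>\<^sub>M M) (\<lambda>(s,t). of_bool (t < s) * (f s * g t))"
    by (rule Bochner_Integration.integrable_bound[OF fg]) auto
  have 1: "(LINT s|M. of_bool (s \<le> t) * (f s * g t)) = F t * g t" for t
  proof -
    have "(LINT s|M. of_bool (s \<le> t) * (f s * g t)) = (LINT s|M. indicator {..t} s * f s * g t)"
      by (rule Bochner_Integration.integral_cong) (auto simp: indicator_def)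
    then show ?thesis by (simp add: F_def M_def)
  qed
  \<comment> \<open>The second triangle is open (\<open>t < s\<close>) while \<open>G\<close>
    integrates up to and including \<open>s\<close>; the difference is a single point.\<close>
  have sing: "AE t in M. t \<noteq> s" for s
  proof -
    have "AE t in lebesgue. t \<noteq> s" by (rule AE_completion) (rule AE_lborel_singleton)
    then show ?thesis unfolding M_def using S by (auto simp: AE_restrict_space_iff fmeasurableD elim!: eventually_mono)
  qed
  have 2: "(LINT t|M. of_bool (t < s) * (f s * g t)) = f s * G s" for s
  proof -
    have "(LINT t|M. of_bool (t < s) * (f s * g t)) = (LINT t|M. f s * (indicator {..s} t * g t))"
    proof (rule integral_cong_AE)
      show "AE t in M. of_bool (t < s) * (f s * g t) = f s * (indicator {..s} t * g t)"
        using sing[of s] by eventually_elim (auto simp: indicator_def)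
    qed auto
    then show ?thesis by (simp add: G_def M_def)
  qed
  have "integrable M (\<lambda>t. F t * g t)" "integrable M (\<lambda>t. f t * G t)"
    using P.integrable_snd[OF ind] P.integrable_fst[OF ind'] unfolding 1 2 .
  then show "integrable (lebesgue_on S) (\<lambda>t. F t * g t)" "integrable (lebesgue_on S) (\<lambda>t. f t * G t)"
    by (simp_all add: M_def)
  have "(LINT t|M. F t * g t) + (LINT t|M. f t * G t) 
     = integral\<^sup>L (M \<Otimes>\<^sub>M M) (\<lambda>(s,t). of_bool (s \<le> t) * (f s * g t)) 
     + integral\<^sup>L (M \<Otimes>\<^sub>M M) (\<lambda>(s,t). of_bool (t < s) * (f s * g t))"
    using P.integral_snd[OF ind] P.integral_fst[OF ind'] by (simp add: 1 2)
  also have "\<dots> = integral\<^sup>L (M \<Otimes>\<^sub>M M) (\<lambda>x. (case x of (s,t) \<Rightarrow> of_bool (s \<le> t) * (f s * g t)) + (case x of (s,t) \<Rightarrow> of_bool (t < s) * (f s * g t)))"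
    by (rule Bochner_Integration.integral_add[OF ind ind', symmetric])
  also have "\<dots> = integral\<^sup>L (M \<Otimes>\<^sub>M M) (\<lambda>(s,t). f s * g t)"
    by (rule Bochner_Integration.integral_cong) auto
  also have "\<dots> = (LINT s|M. LINT t|M. f s * g t)" using P.integral_fst[OF fg] by simp
  also have "\<dots> = (LINT t|M. f t) * (LINT t|M. g t)" by simp
  finally show "(LINT t|lebesgue_on S. F t * g t) + (LINT t|lebesgue_on S. f t * G t)
     = (LINT t|lebesgue_on S. f t) * (LINT t|lebesgue_on S. g t)" by (simp add: M_def)
qed

text \<open>The Stieltjes measures of \<open>L\<close> and of \<open>C * t - L t\<close> add up to
  \<open>C\<close> times Lebesgue measure. Hence both are absolutely continuous, and the two
  Radon-Nikodym densities sum to \<open>C\<close>, which bounds the first one.\<close>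

lemma lipschitz_mono_has_density:
  fixes L :: "real \<Rightarrow> real"
  assumes mono: "\<And>s t. s \<le> t \<Longrightarrow> L s \<le> L t"
    and lip: "\<And>s t. s \<le> t \<Longrightarrow> L t - L s \<le> C * (t - s)"
  obtains l where "l \<in> borel_measurable borel" "\<And>t. 0 \<le> l t" "\<And>t. l t \<le> C"
    "\<And>a b. a \<le> b \<Longrightarrow> (l has_integral (L b - L a)) {a..b}"
proof -
  have C: "C \<ge> 0" using mono[of 0 1] lip[of 0 1] by simp
  define G where "G t = C * t - L t" for t
  have monoG: "G s \<le> G t" if "s \<le> t" for s t using lip[OF that] by (simp add: G_def algebra_simps)
  have "C-lipschitz_on UNIV L"
  proof (rule lipschitz_onI)
    show "dist (L x) (L y) \<le> C * dist x y" for x y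
      using mono[of x y] lip[of x y] mono[of y x] lip[of y x] by (cases "x \<le> y") (auto simp: dist_real_def)
  qed (rule C)
  then have contL: "continuous_on UNIV L" by (rule lipschitz_on_continuous_on)
  then have rcL: "continuous (at_right a) L" for a
    by (meson UNIV_I continuous_at_imp_continuous_within continuous_on_eq_continuous_at open_UNIV)
  have "continuous_on UNIV G" unfolding G_def by (intro continuous_intros contL)
  then have rcG: "continuous (at_right a) G" for a
    by (meson UNIV_I continuous_at_imp_continuous_within continuous_on_eq_continuous_at open_UNIV)
  define \<mu> where "\<mu> = interval_measure L"
  define \<nu> where "\<nu> = interval_measure G"
  have s[simp, measurable_cong]: "sets \<mu> = sets borel" "sets \<nu> = sets borel" by (simp_all add: \<mu>_def \<nu>_def)
  define \<sigma> where "\<sigma> = measure_of UNIV (sets borel) (\<lambda>A. emeasure \<mu> A + emeasure \<nu> A)"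
  have s\<sigma>[simp]: "sets \<sigma> = sets borel" unfolding \<sigma>_def by (subst sets_measure_of) (auto simp: sets.sigma_sets_eq[of borel, simplified])
  have e\<sigma>: "emeasure \<sigma> A = emeasure \<mu> A + emeasure \<nu> A" if "A \<in> sets borel" for A
    unfolding \<sigma>_def
  proof (rule emeasure_measure_of_sigma)
    show "sigma_algebra UNIV (sets borel :: real set set)"
      by (metis sets.sigma_algebra_axioms space_borel)
    show "positive (sets borel) (\<lambda>A. emeasure \<mu> A + emeasure \<nu> A)" by (simp add: positive_def)
    show "countably_additive (sets borel) (\<lambda>A. emeasure \<mu> A + emeasure \<nu> A)"
      unfolding countably_additive_def
      by (auto simp: suminf_add[symmetric] suminf_emeasure)
  qed fact
  have "\<sigma> = density lborel (\<lambda>_. ennreal C)"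
  \<comment> \<open>Half-open intervals suffice to compare the two measures; on them the increments
    of \<open>L\<close> and \<open>G\<close> add up to \<open>C * (b - a)\<close>.\<close>
  proof (rule measure_eqI_generator_eq[where E="range (\<lambda>(a, b). {a<..b::real})" and \<Omega>=UNIV and A="\<lambda>n. {-real n<..real n}"])
    show "Int_stable (range (\<lambda>(a, b). {a<..b::real}))"
      by (auto simp: Int_stable_def)
    fix X :: "real set" assume "X \<in> range (\<lambda>(a, b). {a<..b::real})"
    then obtain a b where X: "X = {a<..b}" by auto
    show "emeasure \<sigma> X = emeasure (density lborel (\<lambda>_. ennreal C)) X"
    proof (cases "a \<le> b")
      case True
      have "emeasure \<sigma> X = ennreal (L b - L a) + ennreal (G b - G a)"
        using emeasure_interval_measure_Ioc[OF True mono rcL] emeasure_interval_measure_Ioc[OF True monoG rcG]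
        by (simp add: X e\<sigma> \<mu>_def \<nu>_def)
      also have "\<dots> = ennreal (C * (b - a))"
        using mono[OF True] monoG[OF True] by (simp add: ennreal_plus[symmetric] G_def algebra_simps)
      finally show ?thesis using True C by (simp add: X emeasure_density_const ennreal_mult)
    qed (simp add: X)
  next
    show "(\<Union>i. {-real i<..real i}) = UNIV"
    proof (auto)
      fix x :: real
      obtain n where "\<bar>x\<bar> < real n" using reals_Archimedean2 by blast
      then show "\<exists>i. - real i < x \<and> x \<le> real i" by (intro exI[of _ n]) auto
    qed
    show "emeasure \<sigma> {- real i<..real i} \<noteq> \<infinity>" for i
      using emeasure_interval_measure_Ioc[OF _ mono rcL, of "-real i" "real i"] 
        emeasure_interval_measure_Ioc[OF _ monoG rcG, of "-real i" "real i"]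
      by (simp add: e\<sigma> \<mu>_def \<nu>_def)
  qed (auto simp: borel_sigma_sets_Ioc)
  then have sum: "emeasure \<mu> A + emeasure \<nu> A = emeasure (density lborel (\<lambda>_. ennreal C)) A" if "A \<in> sets borel" for A
    using e\<sigma>[OF that] by simp
  have ac: "absolutely_continuous lborel \<mu>" "absolutely_continuous lborel \<nu>"
    using sum by (auto simp: absolutely_continuous_def null_sets_def emeasure_density_const)
      (metis add_eq_0_iff_both_eq_0 mult_zero_right)+
  obtain f where f[measurable]: "f \<in> borel_measurable lborel" and df: "density lborel f = \<mu>"
    using sigma_finite_measure.Radon_Nikodym[OF sigma_finite_lborel ac(1)] by auto
  obtain g where g[measurable]: "g \<in> borel_measurable lborel" and dg: "density lborel g = \<nu>"
    using sigma_finite_measure.Radon_Nikodym[OF sigma_finite_lborel ac(2)] by auto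
  have "AE x in lborel. f x + g x = ennreal C"
  proof (rule sigma_finite_measure.density_unique2[OF sigma_finite_lborel])
    fix A :: "real set" assume A[measurable]: "A \<in> sets lborel"
    have "(\<integral>\<^sup>+x\<in>A. (f x + g x)\<partial>lborel) = (\<integral>\<^sup>+x\<in>A. f x\<partial>lborel) + (\<integral>\<^sup>+x\<in>A. g x\<partial>lborel)"
      by (simp add: distrib_right nn_integral_add)
    also have "\<dots> = emeasure \<mu> A + emeasure \<nu> A"
      unfolding df[symmetric] dg[symmetric] using f g A by (simp add: emeasure_density)
    also have "\<dots> = (\<integral>\<^sup>+x\<in>A. ennreal C\<partial>lborel)" using A by (simp add: sum emeasure_density)
    finally show "(\<integral>\<^sup>+x\<in>A. (f x + g x)\<partial>lborel) = (\<integral>\<^sup>+x\<in>A. ennreal C\<partial>lborel)" .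
  qed auto
  then have fC: "AE x in lborel. f x \<le> ennreal C"
    by eventually_elim (metis le_iff_add)
  \<comment> \<open>The density is extended real valued and at most \<open>C\<close> only almost
    everywhere; truncation gives a real version with bounds at every point.\<close>
  define l where "l x = enn2real (min (f x) (ennreal C))" for x
  have fl: "AE x in lborel. f x = ennreal (l x)"
    using fC by eventually_elim (simp add: l_def min_absorb1 ennreal_enn2real_if top.not_eq_extremum le_less_trans)
  show ?thesis
  proof
    show [measurable]: "l \<in> borel_measurable borel" unfolding l_def using f by simp
    show l0: "0 \<le> l t" for t by (simp add: l_def)
    show "l t \<le> C" for t
      using enn2real_mono[of "min (f t) (ennreal C)" "ennreal C"] C by (simp add: l_def)
    fix a b :: real assume ab: "a \<le> b"
    have "(\<integral>\<^sup>+x. ennreal (indicator {a<..b} x * l x) \<partial>lborel) = (\<integral>\<^sup>+x\<in>{a<..b}. f x\<partial>lborel)"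
      by (rule nn_integral_cong_AE) (use fl in \<open>auto simp: indicator_def elim!: eventually_mono\<close>)
    also have "\<dots> = emeasure \<mu> {a<..b}" unfolding df[symmetric] using f by (simp add: emeasure_density)
    also have "\<dots> = ennreal (L b - L a)" unfolding \<mu>_def by (rule emeasure_interval_measure_Ioc[OF ab mono rcL])
    finally have "has_bochner_integral lborel (\<lambda>x. indicator {a<..b} x * l x) (L b - L a)"
      using mono[OF ab] l0 by (intro has_bochner_integral_nn_integral) auto
    then have "((\<lambda>x. indicator {a<..b} x * l x) has_integral (L b - L a)) UNIV"
      using has_integral_integral_lborel has_bochner_integral_iff by metis
    moreover have "(\<lambda>x. indicator {a<..b} x * l x) = (\<lambda>x. if x \<in> {a<..b} then l x else 0)"
      by (auto simp: indicator_def)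
    ultimately have "(l has_integral (L b - L a)) {a<..b}"
      by (simp only: has_integral_restrict_UNIV)
    moreover have "negligible {x \<in> {a<..b} - {a..b}. l x \<noteq> 0}" "negligible {x \<in> {a..b} - {a<..b}. l x \<noteq> 0}"
      by (rule negligible_subset[of "{a}"]; auto)+
    ultimately show "(l has_integral (L b - L a)) {a..b}"
      using has_integral_spike_set_eq by blast
  qed
qed

section \<open>Weak derivatives\<close>

text \<open>The cut-off by an indicator inside a fixed domain makes this total in \<open>t\<close>
  (constant outside \<open>[0,T]\<close>) and puts it in the form of the functions \<open>F\<close>
  and \<open>G\<close> of \<open>integral_by_parts_indefinite\<close>.\<close>

definition primitive :: "real \<Rightarrow> (real \<Rightarrow> real) \<Rightarrow> real \<Rightarrow> real" where
  "primitive T v t = (LINT s|lebesgue_on {0<..<T}. indicator {..t} s * v s)"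

lemma L2_imp_integrable:
  assumes "v \<in> L2 T"
  shows "integrable (lebesgue_on {0<..<T}) v"
proof (rule Bochner_Integration.integrable_bound)
  have "finite_measure (lebesgue_on {0<..<T})" by (rule finite_measure_lebesgue_on) simp
  then show "integrable (lebesgue_on {0<..<T}) (\<lambda>t. 1 + (v t)\<^sup>2)"
    using assms by (auto simp: L2_def finite_measure.integrable_const)
  show "v \<in> borel_measurable (lebesgue_on {0<..<T})" using assms by (simp add: L2_def)
  have "\<bar>x\<bar> \<le> 1 + x\<^sup>2" for x :: real
    using zero_le_power2[of "\<bar>x\<bar> - 1/2"] by (simp add: power2_eq_square algebra_simps)
  then show "AE x in lebesgue_on {0<..<T}. norm (v x) \<le> norm (1 + (v x)\<^sup>2)" by simp
qed

lemma L2_diff: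
  assumes "u \<in> L2 T" "v \<in> L2 T"
  shows "(\<lambda>t. u t - v t) \<in> L2 T"
proof -
  have [measurable]: "u \<in> borel_measurable (lebesgue_on {0<..<T})" "v \<in> borel_measurable (lebesgue_on {0<..<T})"
    using assms by (auto simp: L2_def)
  have "integrable (lebesgue_on {0<..<T}) (\<lambda>t. (u t - v t)\<^sup>2)"
  proof (rule Bochner_Integration.integrable_bound)
    show "integrable (lebesgue_on {0<..<T}) (\<lambda>t. 2 * (u t)\<^sup>2 + 2 * (v t)\<^sup>2)" 
      using assms by (auto simp: L2_def)
    have "(x - y)\<^sup>2 \<le> 2 * x\<^sup>2 + 2 * y\<^sup>2" for x y :: real
      using zero_le_power2[of "x + y"] by (simp add: power2_eq_square algebra_simps)
    then show "AE t in lebesgue_on {0<..<T}. norm ((u t - v t)\<^sup>2) \<le> norm (2 * (u t)\<^sup>2 + 2 * (v t)\<^sup>2)" by simp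
  qed auto
  then show ?thesis by (simp add: L2_def)
qed

lemma L2_bounded:
  assumes v: "v \<in> borel_measurable (lebesgue_on {0<..<T})" and b: "\<And>t. t \<in> {0<..<T} \<Longrightarrow> \<bar>v t\<bar> \<le> B"
  shows "v \<in> L2 T"
proof -
  interpret finite_measure "lebesgue_on {0<..<T}" by (rule finite_measure_lebesgue_on) simp
  have "integrable (lebesgue_on {0<..<T}) (\<lambda>t. (v t)\<^sup>2)"
  proof (rule integrable_const_bound)
    show "AE t in lebesgue_on {0<..<T}. norm ((v t)\<^sup>2) \<le> B\<^sup>2"
    proof (rule AE_I2)
      fix t assume "t \<in> space (lebesgue_on {0<..<T})"
      then have "\<bar>v t\<bar> \<le> B" using b by simp
      then show "norm ((v t)\<^sup>2) \<le> B\<^sup>2" using power_mono[of "\<bar>v t\<bar>" B 2] by simp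
    qed
  qed (use v in measurable)
  with v show ?thesis by (simp add: L2_def)
qed

lemma continuous_imp_measurable_Ioo:
  fixes u :: "real \<Rightarrow> real"
  assumes "continuous_on {0..T} u"
  shows "u \<in> borel_measurable (lebesgue_on {0<..<T})"
  by (rule continuous_imp_measurable_on_sets_lebesgue[OF continuous_on_subset[OF assms]]) auto

lemma L2_continuous:
  assumes "continuous_on {0..T} u"
  shows "u \<in> L2 T"
proof -
  have "bounded (u ` {0..T})"
    using assms by (intro compact_imp_bounded compact_continuous_image) auto
  then obtain B where "\<forall>x\<in>{0..T}. \<bar>u x\<bar> \<le> B" by (auto simp: bounded_iff)
  then show ?thesis by (intro L2_bounded[OF continuous_imp_measurable_Ioo[OF assms]]) auto
qed

lemma integrable_indicator_mult:
  fixes v :: "real \<Rightarrow> real"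
  assumes "integrable (lebesgue_on S) v" "S \<in> sets lebesgue"
  shows "integrable (lebesgue_on S) (\<lambda>s. indicator {..t} s * v s)"
proof (rule Bochner_Integration.integrable_bound[OF assms(1)])
  have "indicat_real {..t} \<in> borel_measurable (lebesgue_on S)"
    by (intro measurable_restrict_space1 borel_measurable_indicator) auto
  then show "(\<lambda>s. indicator {..t} s * v s) \<in> borel_measurable (lebesgue_on S)"
    using assms by (intro borel_measurable_times) auto
qed (auto simp: indicator_def)

lemma primitive_eq_integral:
  assumes v: "integrable (lebesgue_on {0<..<T}) v" and t: "t \<in> {0..T}"
  shows "v integrable_on {0..t}" "primitive T v t = integral {0..t} v"
proof -
  have s: "negligible (sym_diff ({..t} \<inter> {0<..<T}) {0..t})"
    by (rule negligible_subset[of "{0,T}"]) (use t in auto)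
  have i: "integrable (lebesgue_on {0<..<T}) (\<lambda>s. indicator {..t} s * v s)"
    by (rule integrable_indicator_mult[OF v]) auto
  have eq: "(\<lambda>s. indicator {..t} s * v s) = (\<lambda>s. if s \<in> {..t} then v s else 0)" by (auto simp: indicator_def)
  have "((\<lambda>s. if s \<in> {..t} then v s else 0) has_integral primitive T v t) {0<..<T}"
    using has_integral_integral_lebesgue_on[OF i] unfolding primitive_def eq by simp
  then have "(v has_integral primitive T v t) ({..t} \<inter> {0<..<T})"
    by (simp only: has_integral_restrict_Int)
  moreover have "(v has_integral primitive T v t) ({..t} \<inter> {0<..<T}) \<longleftrightarrow> (v has_integral primitive T v t) {0..t}"
  proof (rule has_integral_spike_set_eq)
    show "negligible {x \<in> {..t} \<inter> {0<..<T} - {0..t}. v x \<noteq> 0}"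
      by (rule negligible_subset[OF s]) blast
    show "negligible {x \<in> {0..t} - {..t} \<inter> {0<..<T}. v x \<noteq> 0}"
      by (rule negligible_subset[OF s]) blast
  qed
  ultimately have "(v has_integral primitive T v t) {0..t}" by blast
  then show "v integrable_on {0..t}" "primitive T v t = integral {0..t} v"
    by (auto simp: integral_unique)
qed

lemma primitive_continuous:
  assumes v: "integrable (lebesgue_on {0<..<T}) v"
  shows "continuous_on {0..T} (primitive T v)"
proof (cases "T \<ge> 0")
  case True
  then have "v integrable_on {0..T}" using primitive_eq_integral(1)[OF v, of T] by auto
  then have "continuous_on {0..T} (\<lambda>t. integral {0..t} v)"
    by (rule indefinite_integral_continuous_1)
  then show ?thesis by (subst continuous_on_cong[OF refl primitive_eq_integral(2)[OF v]])
qed simp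

lemma primitive_0: "primitive T v 0 = 0"
proof -
  have "primitive T v 0 = (LINT s|lebesgue_on {0<..<T}. 0)"
    unfolding primitive_def by (rule Bochner_Integration.integral_cong) (auto simp: indicator_def)
  then show ?thesis by simp
qed

lemma primitive_of_derivative:
  assumes "\<And>x. (\<eta> has_real_derivative h x) (at x)" "continuous_on UNIV h" and t: "t \<in> {0..T}"
  shows "primitive T h t = \<eta> t - \<eta> 0"
proof -
  have "integrable (lebesgue_on {0<..<T}) h"
    using assms(2) by (intro L2_imp_integrable L2_continuous) (auto intro: continuous_on_subset)
  moreover have "(h has_integral (\<eta> t - \<eta> 0)) {0..t}"
    using t assms(1) by (intro fundamental_theorem_of_calculus) 
      (auto simp: has_real_derivative_iff_has_vector_derivative intro: has_vector_derivative_at_within)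
  ultimately show ?thesis using t by (simp add: primitive_eq_integral integral_unique)
qed

lemma primitive_T:
  assumes "T \<ge> 0"
  shows "primitive T v T = (LINT s|lebesgue_on {0<..<T}. v s)"
  unfolding primitive_def by (rule Bochner_Integration.integral_cong) (auto simp: indicator_def)

lemma test_functionD:
  assumes "test_function T \<eta>" "T > 0"
  shows "(\<eta> has_real_derivative deriv \<eta> x) (at x)" "continuous_on UNIV (deriv \<eta>)" "\<eta> 0 = 0" "\<eta> T = 0"
proof -
  have C1: "\<eta> C1_differentiable_on UNIV" and sub: "closure {t. \<eta> t \<noteq> 0} \<subseteq> {0<..<T}"
    using assms by (auto simp: test_function_def)
  obtain D where D: "\<And>x. (\<eta> has_vector_derivative D x) (at x)" "continuous_on UNIV D"
    using C1 by (auto simp: C1_differentiable_on_def)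
  then have D': "(\<eta> has_real_derivative D x) (at x)" for x
    by (simp add: has_real_derivative_iff_has_vector_derivative)
  then have "deriv \<eta> = D" by (auto intro: DERIV_imp_deriv)
  then show "(\<eta> has_real_derivative deriv \<eta> x) (at x)" "continuous_on UNIV (deriv \<eta>)" using D D' by auto
  show "\<eta> 0 = 0" "\<eta> T = 0" using sub closure_subset[of "{t. \<eta> t \<noteq> 0}"] by force+
qed

text \<open>Integration by parts against the derivative of \<open>\<eta>\<close>, whose primitive is
  \<open>\<eta>\<close> itself. The product term vanishes because that derivative has integral
  \<open>\<eta> T - \<eta> 0 = 0\<close>.\<close>

lemma primitive_weak_identity:
  assumes "T > 0" and v: "integrable (lebesgue_on {0<..<T}) v" and \<eta>: "test_function T \<eta>"
  shows "(LINT t|lebesgue_on {0<..<T}. primitive T v t * deriv \<eta> t) = - (LINT t|lebesgue_on {0<..<T}. v t * \<eta> t)"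
proof -
  note D = test_functionD[OF \<eta> \<open>T > 0\<close>]
  have i: "integrable (lebesgue_on {0<..<T}) (deriv \<eta>)"
    using D(2) by (intro L2_imp_integrable L2_continuous) (auto intro: continuous_on_subset)
  have p: "primitive T (deriv \<eta>) t = \<eta> t" if "t \<in> {0..T}" for t
    using primitive_of_derivative[OF D(1,2) that] D(3) by simp
  have "(LINT t|lebesgue_on {0<..<T}. primitive T v t * deriv \<eta> t) + (LINT t|lebesgue_on {0<..<T}. v t * primitive T (deriv \<eta>) t)
     = (LINT t|lebesgue_on {0<..<T}. v t) * (LINT t|lebesgue_on {0<..<T}. deriv \<eta> t)"
    unfolding primitive_def by (rule integral_by_parts_indefinite(3)[OF _ v i]) simp
  also have "(LINT t|lebesgue_on {0<..<T}. deriv \<eta> t) = 0"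
    using primitive_T[of T "deriv \<eta>"] p[of T] D(4) \<open>T > 0\<close> by simp
  also have "(LINT t|lebesgue_on {0<..<T}. v t * primitive T (deriv \<eta>) t) = (LINT t|lebesgue_on {0<..<T}. v t * \<eta> t)"
    by (rule Bochner_Integration.integral_cong) (use p in auto)
  finally show ?thesis by simp
qed

lemma has_weak_deriv_primitive:
  assumes "T > 0" and v: "v \<in> L2 T" and u: "\<And>t. t \<in> {0..T} \<Longrightarrow> u t = c + primitive T v t"
  shows "has_weak_deriv T u v"
  unfolding has_weak_deriv_def
proof (intro conjI allI impI)
  have vi: "integrable (lebesgue_on {0<..<T}) v" using v by (rule L2_imp_integrable)
  have pc: "continuous_on {0..T} (primitive T v)" by (rule primitive_continuous[OF vi])
  have "continuous_on {0..T} u" 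
    using u by (subst continuous_on_cong[OF refl u]) (auto intro!: continuous_intros pc)
  then show "u \<in> L2 T" by (rule L2_continuous)
  fix \<eta> assume \<eta>: "test_function T \<eta>"
  note D = test_functionD[OF \<eta> \<open>T > 0\<close>]
  have Dc: "continuous_on {0..T} (deriv \<eta>)" using D(2) by (rule continuous_on_subset) simp
  have i: "integrable (lebesgue_on {0<..<T}) (deriv \<eta>)"
    by (intro L2_imp_integrable L2_continuous Dc)
  have i2: "integrable (lebesgue_on {0<..<T}) (\<lambda>t. primitive T v t * deriv \<eta> t)"
    by (intro L2_imp_integrable L2_continuous continuous_intros pc Dc)
  have z: "(LINT t|lebesgue_on {0<..<T}. deriv \<eta> t) = 0"
    using primitive_T[of T "deriv \<eta>"] primitive_of_derivative[OF D(1,2), of T T] D(3,4) \<open>T > 0\<close> by simp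
  have "(LINT t|lebesgue_on {0<..<T}. u t * deriv \<eta> t) 
    = (LINT t|lebesgue_on {0<..<T}. c * deriv \<eta> t + primitive T v t * deriv \<eta> t)"
    by (rule Bochner_Integration.integral_cong) (auto simp: u algebra_simps)
  also have "\<dots> = (LINT t|lebesgue_on {0<..<T}. primitive T v t * deriv \<eta> t)"
    using i i2 z by simp
  also have "\<dots> = - (LINT t|lebesgue_on {0<..<T}. v t * \<eta> t)"
    by (rule primitive_weak_identity[OF \<open>T > 0\<close> vi \<eta>])
  finally show "(LINT t|lebesgue_on {0<..<T}. u t * deriv \<eta> t) = - (LINT t|lebesgue_on {0<..<T}. v t * \<eta> t)" .
qed (fact v)

text \<open>The du Bois-Reymond lemma: \<open>W\<close>, the difference of \<open>u\<close> and the
  primitive, is orthogonal to all derivatives of test functions. Testing with a primitive of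
  \<open>(W - c) * \<psi>\<close>, for a bump \<open>\<psi>\<close> and a suitable mean
  \<open>c\<close>, forces \<open>W = c\<close> where \<open>\<psi>\<close> is positive.\<close>

lemma weak_deriv_imp_primitive:
  assumes "T > 0" and w: "has_weak_deriv T u v" and cont: "continuous_on {0..T} u" and t: "t \<in> {0..T}"
  shows "u t = u 0 + primitive T v t"
proof -
  have vi: "integrable (lebesgue_on {0<..<T}) v" 
    using w by (auto simp: has_weak_deriv_def intro: L2_imp_integrable)
  have pc: "continuous_on {0..T} (primitive T v)" by (rule primitive_continuous[OF vi])
  define W where "W t = u t - primitive T v t" for t
  have Wc: "continuous_on {0..T} W" unfolding W_def by (intro continuous_intros pc cont)
  have weak: "(LINT t|lebesgue_on {0<..<T}. W t * deriv \<eta> t) = 0" if \<eta>: "test_function T \<eta>" for \<eta>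
  proof -
    have Dc: "continuous_on {0..T} (deriv \<eta>)" 
      using test_functionD(2)[OF \<eta> \<open>T > 0\<close>] by (rule continuous_on_subset) simp
    have i: "integrable (lebesgue_on {0<..<T}) (\<lambda>t. u t * deriv \<eta> t)"
      "integrable (lebesgue_on {0<..<T}) (\<lambda>t. primitive T v t * deriv \<eta> t)"
      by (intro L2_imp_integrable L2_continuous continuous_intros cont pc Dc)+
    show ?thesis
      using w \<eta> primitive_weak_identity[OF \<open>T > 0\<close> vi \<eta>]
      by (simp add: W_def left_diff_distrib has_weak_deriv_def Bochner_Integration.integral_diff[OF i])
  qed
  have const: "W x = W y" if xy: "0 < x" "x < y" "y < T" for x y
  proof -
    define a b where "a = x / 2" and "b = (y + T) / 2"
    \<comment> \<open>The interval \<open>(a, b)\<close> contains both points to be compared and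
      stays away from 0 and \<open>T\<close>, so that the test function has compact support.\<close>
    have ab: "0 < a" "a < x" "y < b" "b < T" "a < b" using xy by (auto simp: a_def b_def)
    \<comment> \<open>A merely continuous bump is enough: the test function is a primitive of a
      multiple of it, hence of class C1.\<close>
    define \<psi> where "\<psi> s = max 0 ((s - a) * (b - s))" for s :: real
    have \<psi>0: "\<psi> s = 0" if "s \<le> a \<or> b \<le> s" for s
    proof -
      have "(s - a) * (b - s) \<le> 0"
        using that ab mult_nonpos_nonneg[of "s - a" "b - s"] mult_nonneg_nonpos[of "s - a" "b - s"] by auto
      then show ?thesis by (simp add: \<psi>_def)
    qed
    have \<psi>p: "\<psi> s > 0" if "a < s" "s < b" for s
      using that by (auto simp: \<psi>_def less_max_iff_disj)
    have \<psi>n: "\<psi> s \<ge> 0" for s by (simp add: \<psi>_def)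
    have \<psi>c: "continuous_on A \<psi>" for A unfolding \<psi>_def by (intro continuous_intros)
    have \<psi>i: "\<psi> integrable_on {0..T}" by (rule integrable_continuous_real[OF \<psi>c])
    have "integral {0..T} \<psi> \<noteq> 0"
      using integral_eq_0_iff[OF \<psi>c, of 0 T] \<psi>n \<psi>p[of x] xy ab by auto
    \<comment> \<open>The mean of \<open>W\<close> with weight \<open>\<psi>\<close>, chosen so that
      \<open>h\<close> has integral 0 and its primitive vanishes again beyond
      \<open>b\<close>.\<close>
    define c where "c = integral {0..T} (\<lambda>s. W s * \<psi> s) / integral {0..T} \<psi>"
    \<comment> \<open>Continuity of \<open>W\<close> is known on \<open>[0,T]\<close> only; clamping
      the argument makes \<open>h\<close> continuous on the whole line, as test functions
      require.\<close>
    define h where "h s = (W (max 0 (min s T)) - c) * \<psi> s" for s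
    have hc: "continuous_on A h" for A unfolding h_def
      by (intro continuous_intros \<psi>c continuous_on_compose2[OF Wc]) (use xy in auto)
    have h0: "h s = 0" if "s \<le> a \<or> b \<le> s" for s using \<psi>0[OF that] by (simp add: h_def)
    have hW: "h s = (W s - c) * \<psi> s" if "s \<in> {0..T}" for s using that by (auto simp: h_def)
    have Wpi: "(\<lambda>s. W s * \<psi> s) integrable_on {0..T}"
      by (intro integrable_continuous_real continuous_intros Wc \<psi>c)
    have inth: "integral {0..T} h = 0"
    proof -
      have "integral {0..T} h = integral {0..T} (\<lambda>s. W s * \<psi> s - c * \<psi> s)"
        by (rule Henstock_Kurzweil_Integration.integral_cong) (auto simp: hW algebra_simps)
      also have "\<dots> = integral {0..T} (\<lambda>s. W s * \<psi> s) - c * integral {0..T} \<psi>"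
        using integrable_on_cmult_left[OF \<psi>i, of c] Wpi
        by (subst Henstock_Kurzweil_Integration.integral_diff) auto
      also have "\<dots> = 0" using \<open>integral {0..T} \<psi> \<noteq> 0\<close> by (simp add: c_def)
      finally show ?thesis .
    qed
    define \<eta> where "\<eta> s = integral {0..s} h" for s
    have \<eta>a: "\<eta> s = 0" if "s \<le> a" for s
    proof -
      have "\<eta> s = integral {0..s} (\<lambda>_. 0)" unfolding \<eta>_def
        by (rule Henstock_Kurzweil_Integration.integral_cong) (use that h0 in auto)
      then show ?thesis by simp
    qed
    have \<eta>split: "\<eta> s = \<eta> b + integral {b..s} h" if "b \<le> s" for s
      unfolding \<eta>_def using that ab
      by (intro Henstock_Kurzweil_Integration.integral_combine[symmetric] integrable_continuous_real hc) auto
    have tail: "integral {b..s} h = 0" for s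
    proof -
      have "integral {b..s} h = integral {b..s} (\<lambda>_. 0)"
        by (rule Henstock_Kurzweil_Integration.integral_cong) (use h0 in auto)
      then show ?thesis by simp
    qed
    have "\<eta> b = 0" using \<eta>split[of T] tail[of T] inth ab by (simp add: \<eta>_def)
    then have \<eta>b: "\<eta> s = 0" if "b \<le> s" for s using \<eta>split[OF that] tail by simp
    have deriv: "(\<eta> has_real_derivative h s) (at s)" for s
    proof (cases "s < a")
      case True
      have "((\<lambda>_. 0) has_real_derivative 0) (at s)" by simp
      then have "(\<eta> has_real_derivative 0) (at s)"
        by (rule has_field_derivative_transform_within_open[where S="{..<a}"]) (use True \<eta>a in auto)
      then show ?thesis using h0[of s] True by simp
    next
      case False
      have "(\<eta> has_real_derivative h s) (at s within {0..s+1})"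
        unfolding \<eta>_def by (rule integral_has_real_derivative[OF hc]) (use False ab in auto)
      then show ?thesis using at_within_interior[of s "{0..s+1}"] False ab by simp
    qed
    then have d\<eta>: "deriv \<eta> = h" by (auto intro: DERIV_imp_deriv)
    have supp: "{t. \<eta> t \<noteq> 0} \<subseteq> {a..b}"
    proof
      fix s assume "s \<in> {t. \<eta> t \<noteq> 0}"
      then have "\<not> s \<le> a" "\<not> b \<le> s" using \<eta>a[of s] \<eta>b[of s] by auto
      then show "s \<in> {a..b}" by simp
    qed
    then have csupp: "closure {t. \<eta> t \<noteq> 0} \<subseteq> {a..b}" by (simp add: closure_minimal)
    have "compact (closure {t. \<eta> t \<noteq> 0})"
      using supp by (simp add: compact_closure) (meson bounded_closed_interval bounded_subset)
    moreover have "\<eta> C1_differentiable_on UNIV"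
      unfolding C1_differentiable_on_def using deriv hc
      by (auto simp: has_real_derivative_iff_has_vector_derivative)
    ultimately have "test_function T \<eta>" using csupp ab by (auto simp: test_function_def)
    then have "(LINT t|lebesgue_on {0<..<T}. W t * h t) = 0" using weak[of \<eta>] by (simp add: d\<eta>)
    moreover have Whi: "integrable (lebesgue_on {0<..<T}) (\<lambda>t. W t * h t)"
      by (intro L2_imp_integrable L2_continuous continuous_intros Wc hc)
    ultimately have Wh: "integral {0..T} (\<lambda>t. W t * h t) = 0"
      using primitive_eq_integral(2)[OF Whi, of T] primitive_T[of T] \<open>T > 0\<close> by simp
    \<comment> \<open>Since \<open>h\<close> has integral 0, subtracting \<open>c * h\<close> is
      free and completes the orthogonality relation to a square.\<close>
    have "integral {0..T} (\<lambda>s. (W s - c)\<^sup>2 * \<psi> s) = integral {0..T} (\<lambda>s. W s * h s - c * h s)"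
      by (rule Henstock_Kurzweil_Integration.integral_cong) (auto simp: hW power2_eq_square algebra_simps)
    also have "\<dots> = integral {0..T} (\<lambda>s. W s * h s) - c * integral {0..T} h"
      by (subst Henstock_Kurzweil_Integration.integral_diff)
        (auto intro!: integrable_continuous_real continuous_intros Wc hc)
    also have "\<dots> = 0" using Wh inth by simp
    finally have "integral {0..T} (\<lambda>s. (W s - c)\<^sup>2 * \<psi> s) = 0" .
    then have "\<forall>s\<in>{0..T}. (W s - c)\<^sup>2 * \<psi> s = 0"
      by (subst (asm) integral_eq_0_iff) (use \<open>T > 0\<close> \<psi>n in \<open>auto intro!: continuous_intros Wc \<psi>c\<close>)
    then have "W s = c" if "a < s" "s < b" for s using \<psi>p[OF that] that ab by force
    then show "W x = W y" using ab xy by simp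
  qed
  have "W s = W (T/2)" if "s \<in> {0<..<T}" for s
  proof (cases rule: linorder_cases[of s "T/2"])
    case less then show ?thesis using that by (intro const) auto
  next
    case greater then show ?thesis using that by (intro const[symmetric]) auto
  next
    case equal then show ?thesis by (simp only:)
  qed
  note const_mid = this
  have cl: "closure {0<..<T} = {0..T}" using \<open>T > 0\<close> by simp
  have "W s = W (T/2)" if "s \<in> {0..T}" for s
    using continuous_constant_on_closure[of "{0<..<T}" W "W (T/2)" s, unfolded cl, OF Wc const_mid that] .
  then have "W t = W 0" using t by (metis atLeastAtMost_iff order.refl order.trans)
  then show ?thesis by (simp add: W_def primitive_0)
qed

text \<open>Both derivatives have the primitive \<open>u t - u 0\<close> on \<open>[0,T]\<close>,
  hence equal integrals over all half-lines, and these determine an integrable function almost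
  everywhere.\<close>

lemma weak_deriv_unique:
  assumes "T > 0" and w: "has_weak_deriv T u v" "has_weak_deriv T u' v'" 
    and cont: "continuous_on {0..T} u" and eq: "\<And>t. t \<in> {0..T} \<Longrightarrow> u t = u' t"
  shows "AE t in lebesgue_on {0<..<T}. v t = v' t"
proof -
  have cont': "continuous_on {0..T} u'" by (rule continuous_on_eq[OF cont eq])
  have i: "integrable (lebesgue_on {0<..<T}) v" "integrable (lebesgue_on {0<..<T}) v'"
    using w by (auto simp: has_weak_deriv_def intro: L2_imp_integrable)
  have p: "primitive T v t = primitive T v' t" for t
  proof -
    have "primitive T f t = primitive T f (max 0 (min t T))" for f
      unfolding primitive_def by (rule Bochner_Integration.integral_cong) (auto simp: indicator_def)
    moreover have "primitive T v s = primitive T v' s" if "s \<in> {0..T}" for s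
      using weak_deriv_imp_primitive[OF \<open>T > 0\<close> w(1) cont that] 
        weak_deriv_imp_primitive[OF \<open>T > 0\<close> w(2) cont' that] eq[OF that] eq[of 0] that by simp
    moreover have "max 0 (min t T) \<in> {0..T}" using \<open>T > 0\<close> by auto
    ultimately show ?thesis by metis
  qed
  have "AE t in lebesgue_on {0<..<T}. v t - v' t = 0"
  proof (rule AE_zero_if_integrals_atMost_zero)
    fix t
    have "(LINT s|lebesgue_on {0<..<T}. indicator {..t} s * (v s - v' s)) 
      = (LINT s|lebesgue_on {0<..<T}. indicator {..t} s * v s - indicator {..t} s * v' s)"
      by (simp add: right_diff_distrib)
    also have "\<dots> = primitive T v t - primitive T v' t"
      unfolding primitive_def
      by (intro Bochner_Integration.integral_diff integrable_indicator_mult i) auto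
    finally show "(LINT s|lebesgue_on {0<..<T}. indicator {..t} s * (v s - v' s)) = 0" using p by simp
  qed (use i in auto)
  then show ?thesis by eventually_elim simp
qed

section \<open>Running maxima and weighted contractions\<close>

text \<open>The regulator of the one-dimensional Skorokhod map: the smallest nondecreasing
  nonnegative majorant of \<open>f\<close> on times from 0 on.\<close>

definition running_max :: "(real \<Rightarrow> real) \<Rightarrow> real \<Rightarrow> real" where
  "running_max f t = (SUP s\<in>{0..t}. max 0 (f s))"

context
  fixes f :: "real \<Rightarrow> real" and T :: real
  assumes cont: "continuous_on {0..T} f"
begin

lemma running_max_bdd: 
  assumes "t \<le> T"
  shows "bdd_above ((\<lambda>s. max 0 (f s)) ` {0..t})"
proof -
  have "continuous_on {0..t} (\<lambda>s. max 0 (f s))"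
    using assms by (intro continuous_intros continuous_on_subset[OF cont]) auto
  then show ?thesis
    by (intro bounded_imp_bdd_above compact_imp_bounded compact_continuous_image) auto
qed

lemma running_max_upper:
  assumes "0 \<le> s" "s \<le> t" "t \<le> T"
  shows "f s \<le> running_max f t" "0 \<le> running_max f t"
proof -
  have "max 0 (f s) \<le> running_max f t" unfolding running_max_def
    by (rule cSUP_upper[OF _ running_max_bdd]) (use assms in auto)
  then show "f s \<le> running_max f t" "0 \<le> running_max f t" by auto
qed

lemma running_max_least:
  assumes "0 \<le> t" "0 \<le> c" "\<And>s. 0 \<le> s \<Longrightarrow> s \<le> t \<Longrightarrow> f s \<le> c"
  shows "running_max f t \<le> c"
  unfolding running_max_def using assms by (intro cSUP_least) auto

lemma running_max_le_max:
  assumes "0 \<le> s" "s \<le> t" "t \<le> T" "\<And>u. s \<le> u \<Longrightarrow> u \<le> t \<Longrightarrow> f u \<le> c"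
  shows "running_max f t \<le> max (running_max f s) c"
proof (rule running_max_least)
  show "f u \<le> max (running_max f s) c" if "0 \<le> u" "u \<le> t" for u
    using running_max_upper(1)[of u s] assms that by (cases "u \<le> s") (auto simp: le_max_iff_disj)
qed (use running_max_upper(2)[of s s] assms in auto)

lemma running_max_mono:
  assumes "0 \<le> s" "s \<le> t" "t \<le> T"
  shows "running_max f s \<le> running_max f t"
  by (rule running_max_least) (use running_max_upper[of _ t] assms in auto)

text \<open>The running maximum at \<open>s\<close> is already at least \<open>f s\<close>, so it
  grows by no more than \<open>f\<close> rises above \<open>f s\<close>. This one-sided bound yields
  continuity here and the Lipschitz estimate for \<open>L\<close> later.\<close>

lemma running_max_increment:
  assumes "0 \<le> s" "s \<le> t" "t \<le> T" "\<And>u. s \<le> u \<Longrightarrow> u \<le> t \<Longrightarrow> f u - f s \<le> e"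
  shows "running_max f t - running_max f s \<le> e"
proof -
  have "running_max f t \<le> max (running_max f s) (f s + e)"
    by (rule running_max_le_max) (use assms(4) in \<open>auto simp: assms algebra_simps\<close>)
  moreover have "f s \<le> running_max f s" using running_max_upper(1)[of s s] assms by simp
  moreover have "0 \<le> e" using assms(4)[of s] assms by simp
  ultimately show ?thesis by auto
qed

lemma running_max_continuous: "continuous_on {0..T} (running_max f)"
proof -
  have uc: "uniformly_continuous_on {0..T} f"
    by (rule compact_uniformly_continuous[OF cont]) simp
  show ?thesis
    unfolding continuous_on_iff
  proof (intro ballI allI impI)
    fix x e :: real assume x: "x \<in> {0..T}" and e: "e > 0"
    obtain d where d: "d > 0" "\<And>x y. x \<in> {0..T} \<Longrightarrow> y \<in> {0..T} \<Longrightarrow> dist y x < d \<Longrightarrow> dist (f y) (f x) < e / 2"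
      using uc e unfolding uniformly_continuous_on_def by (metis half_gt_zero)
    have *: "\<bar>running_max f t - running_max f s\<bar> < e" if "s \<in> {0..T}" "t \<in> {0..T}" "s \<le> t" "t - s < d" for s t
    proof -
      have "running_max f t - running_max f s \<le> e / 2"
      proof (rule running_max_increment)
        fix u assume u: "s \<le> u" "u \<le> t"
        have "dist (f u) (f s) < e / 2"
          by (rule d(2)) (use u that in \<open>auto simp: dist_real_def\<close>)
        then show "f u - f s \<le> e / 2" using abs_ge_self[of "f u - f s"] by (simp add: dist_real_def)
      qed (use that in auto)
      moreover have "running_max f s \<le> running_max f t" by (rule running_max_mono) (use that in auto)
      ultimately show ?thesis using e by simp
    qed
    show "\<exists>d>0. \<forall>x'\<in>{0..T}. dist x' x < d \<longrightarrow> dist (running_max f x') (running_max f x) < e"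
    proof (intro exI[of _ d] conjI ballI impI)
      fix y assume y: "y \<in> {0..T}" "dist y x < d"
      then show "dist (running_max f y) (running_max f x) < e"
        using *[of x y] *[of y x] x by (cases "x \<le> y") (auto simp: dist_real_def)
    qed (use d in auto)
  qed
qed

text \<open>The complementarity of the Skorokhod map: the running maximum grows only where
  \<open>f\<close> touches it. The endpoints are rational so that countably many such intervals
  cover all these times.\<close>

lemma running_max_locally_constant:
  assumes t: "0 < t" "t < T" and less: "f t < running_max f t"
  obtains a b where "a \<in> \<rat>" "b \<in> \<rat>" "0 \<le> a" "a < t" "t < b" "b \<le> T" "running_max f a = running_max f b"
proof -
  \<comment> \<open>A level strictly between the two values; by continuity it separates
    \<open>f\<close> from its running maximum on a neighbourhood of \<open>t\<close>.\<close>
  define c where "c = (f t + running_max f t) / 2"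
  have c: "f t < c" "c < running_max f t" using less by (auto simp: c_def)
  have "isCont f t" "isCont (running_max f) t"
    using cont running_max_continuous t continuous_on_interior[of "{0..T}"] by auto
  then have "(f \<longlongrightarrow> f t) (at t)" "(running_max f \<longlongrightarrow> running_max f t) (at t)"
    by (auto simp: isCont_def)
  then have "eventually (\<lambda>s. f s < c) (at t)" "eventually (\<lambda>s. c < running_max f s) (at t)"
    using c by (auto dest: order_tendstoD)
  then have "eventually (\<lambda>s. f s < c \<and> c < running_max f s) (at t)"
    by eventually_elim simp
  then obtain d where d: "d > 0" "\<And>s. s \<noteq> t \<Longrightarrow> dist s t < d \<Longrightarrow> f s < c \<and> c < running_max f s"
    unfolding eventually_at by auto
  obtain a where a: "a \<in> \<rat>" "max 0 (t - d) < a" "a < t" using Rats_dense_in_real[of "max 0 (t - d)" t] t d by auto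
  obtain b where b: "b \<in> \<rat>" "t < b" "b < min T (t + d)" using Rats_dense_in_real[of t "min T (t + d)"] t d by auto
  have "running_max f b \<le> max (running_max f a) c"
  proof (rule running_max_le_max)
    fix u assume u: "a \<le> u" "u \<le> b"
    have "\<bar>u - t\<bar> < d" using u a b by auto
    then show "f u \<le> c"
      using d(2)[of u] c by (cases "u = t") (auto simp: dist_real_def)
  qed (use a b in auto)
  moreover have "c < running_max f a" using d(2)[of a] a by (auto simp: dist_real_def)
  ultimately have "running_max f b \<le> running_max f a" by simp
  moreover have "running_max f a \<le> running_max f b" by (rule running_max_mono) (use a b in auto)
  ultimately show ?thesis using that[of a b] a b by auto
qed

end

text \<open>The map is nonexpansive, and only times up to \<open>t\<close> enter. The latter makes
  it compatible with a weight that increases in time.\<close>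

lemma running_max_diff_le:
  assumes f: "continuous_on {0..T} f" and g: "continuous_on {0..T} g" and t: "0 \<le> t" "t \<le> T"
    and d: "\<And>s. 0 \<le> s \<Longrightarrow> s \<le> t \<Longrightarrow> \<bar>f s - g s\<bar> \<le> c"
  shows "\<bar>running_max f t - running_max g t\<bar> \<le> c"
proof -
  have c: "0 \<le> c" using d[of 0] t by simp
  have "running_max f t \<le> running_max g t + c"
  proof (rule running_max_least[OF f])
    show "f s \<le> running_max g t + c" if "0 \<le> s" "s \<le> t" for s
      using d[OF that] running_max_upper(1)[OF g, of s t] that t by simp
  qed (use t c running_max_upper(2)[OF g, of t t] f in auto)
  moreover have "running_max g t \<le> running_max f t + c"
  proof (rule running_max_least[OF g])
    show "g s \<le> running_max f t + c" if "0 \<le> s" "s \<le> t" for s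
      using d[OF that] running_max_upper(1)[OF f, of s t] that t by simp
  qed (use t c running_max_upper(2)[OF f, of t t] g in auto)
  ultimately show ?thesis by simp
qed

text \<open>Picard iteration from 0. The weighted distance is expressed by inequalities
  \<open>\<bar>u i t - v i t\<bar> \<le> D * w i t\<close> instead of a supremum of quotients,
  because the weight may vanish, as the concave weight does at both ends.\<close>

lemma weighted_contraction_fixed_point:
  fixes F :: "('i \<Rightarrow> real \<Rightarrow> real) \<Rightarrow> 'i \<Rightarrow> real \<Rightarrow> real" and w :: "'i \<Rightarrow> real \<Rightarrow> real"
  assumes cont: "\<And>u. (\<And>i. continuous_on {0..T} (u i)) \<Longrightarrow> (\<And>i. continuous_on {0..T} (F u i))"
    and w: "\<And>i t. t \<in> {0..T} \<Longrightarrow> 0 \<le> w i t" "\<And>i t. t \<in> {0..T} \<Longrightarrow> w i t \<le> B"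
    and \<rho>: "0 \<le> \<rho>" "\<rho> < 1"
    and contr: "\<And>u v D i t. (\<And>i. continuous_on {0..T} (u i)) \<Longrightarrow> (\<And>i. continuous_on {0..T} (v i)) \<Longrightarrow> 0 \<le> D \<Longrightarrow>
      (\<And>i t. t \<in> {0..T} \<Longrightarrow> \<bar>u i t - v i t\<bar> \<le> D * w i t) \<Longrightarrow> t \<in> {0..T} \<Longrightarrow>
      \<bar>F u i t - F v i t\<bar> \<le> \<rho> * D * w i t"
    and init: "0 \<le> D0" "\<And>i t. t \<in> {0..T} \<Longrightarrow> \<bar>F (\<lambda>_ _. 0) i t\<bar> \<le> D0 * w i t"
  obtains u where "\<And>i. continuous_on {0..T} (u i)" "\<And>i t. t \<in> {0..T} \<Longrightarrow> F u i t = u i t"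
proof -
  define S where "S n = (F ^^ n) (\<lambda>_ _. 0)" for n
  have Sc: "continuous_on {0..T} (S n i)" for n i
    by (induction n arbitrary: i) (auto simp: S_def intro: cont)
  have S_step: "\<bar>S (Suc n) i t - S n i t\<bar> \<le> \<rho> ^ n * D0 * w i t" if "t \<in> {0..T}" for n i t
    using that
  proof (induction n arbitrary: i t)
    case 0
    then show ?case using init(2)[of t i] by (simp add: S_def)
  next
    case (Suc n)
    have "\<bar>F (S (Suc n)) i t - F (S n) i t\<bar> \<le> \<rho> * (\<rho> ^ n * D0) * w i t"
      by (rule contr) (use Suc Sc init \<rho> in auto)
    then show ?case by (simp add: S_def ac_simps)
  qed
  \<comment> \<open>The sum of the geometric series of step sizes. With
    \<open>D0 = (1 - \<rho>) * K\<close> each step is bounded by a difference of powers, so that the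
    bounds telescope.\<close>
  define K where "K = D0 / (1 - \<rho>)"
  have K: "0 \<le> K" using init \<rho> by (simp add: K_def)
  have tele: "\<bar>S m i t - S n i t\<bar> \<le> (\<rho> ^ n - \<rho> ^ m) * K * w i t" if "n \<le> m" "t \<in> {0..T}" for n m i t
    using that(1)
  proof (induction m rule: dec_induct)
    case (step m)
    have D0: "D0 = (1 - \<rho>) * K" using \<rho> by (simp add: K_def)
    have "\<bar>S (Suc m) i t - S m i t\<bar> \<le> (\<rho> ^ m - \<rho> ^ Suc m) * K * w i t"
      using S_step[OF that(2), of m i] unfolding D0 by (simp add: algebra_simps)
    then show ?case using step.IH by (simp add: algebra_simps)
  qed simp
  have tele': "\<bar>S m i t - S n i t\<bar> \<le> \<rho> ^ n * K * w i t" if "n \<le> m" "t \<in> {0..T}" for n m i t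
  proof -
    have "(\<rho> ^ n - \<rho> ^ m) * K * w i t \<le> \<rho> ^ n * K * w i t"
      using K w(1)[OF that(2)] \<rho> by (intro mult_right_mono) auto
    with tele[OF that, of i] show ?thesis by simp
  qed
  have lim0: "(\<lambda>n. \<rho> ^ n * C) \<longlonglongrightarrow> 0" for C
    using tendsto_mult_left_zero[OF LIMSEQ_power_zero[of \<rho>]] \<rho> by simp
  have "Cauchy (\<lambda>n. S n i t)" if t: "t \<in> {0..T}" for i t
  proof (rule metric_CauchyI)
    fix e :: real assume "e > 0"
    then have "eventually (\<lambda>n. \<rho> ^ n * (K * w i t) < e / 2) sequentially"
      using order_tendstoD(2)[OF lim0, of "e/2"] by simp
    then obtain M where M: "\<rho> ^ M * (K * w i t) < e / 2" by (auto simp: eventually_sequentially)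
    have "dist (S m i t) (S M i t) < e / 2" if "m \<ge> M" for m
      using tele'[OF that t, of i] M by (simp add: dist_real_def ac_simps)
    then show "\<exists>M. \<forall>m\<ge>M. \<forall>n\<ge>M. dist (S m i t) (S n i t) < e"
      by (intro exI[of _ M]) (metis dist_triangle_half_l)
  qed
  then have conv: "\<exists>l. (\<lambda>n. S n i t) \<longlonglongrightarrow> l" if "t \<in> {0..T}" for i t
    using that Cauchy_convergent_iff convergent_def by blast
  define u where "u i t = lim (\<lambda>n. S n i t)" for i t
  have ulim: "(\<lambda>n. S n i t) \<longlonglongrightarrow> u i t" if "t \<in> {0..T}" for i t
    using conv[OF that] unfolding u_def by (metis limI)
  have uS: "\<bar>u i t - S n i t\<bar> \<le> \<rho> ^ n * K * w i t" if "t \<in> {0..T}" for i t n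
  proof (rule LIMSEQ_le_const2)
    show "(\<lambda>m. \<bar>S m i t - S n i t\<bar>) \<longlonglongrightarrow> \<bar>u i t - S n i t\<bar>"
      by (intro tendsto_intros ulim that)
    show "\<exists>N. \<forall>m\<ge>N. \<bar>S m i t - S n i t\<bar> \<le> \<rho> ^ n * K * w i t"
      using tele' that by blast
  qed
  have uc: "continuous_on {0..T} (u i)" for i
  proof (rule uniform_limit_theorem)
    show "\<forall>\<^sub>F n in sequentially. continuous_on {0..T} (S n i)" using Sc by simp
    show "uniform_limit {0..T} (\<lambda>n. S n i) (u i) sequentially"
    proof (rule uniform_limitI)
      fix e :: real assume "e > 0"
      then have "eventually (\<lambda>n. \<rho> ^ n * (K * B) < e) sequentially"
        using order_tendstoD(2)[OF lim0] by blast
      then show "\<forall>\<^sub>F n in sequentially. \<forall>x\<in>{0..T}. dist (S n i x) (u i x) < e"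
      proof eventually_elim
        case (elim n)
        show ?case
        proof
          fix x assume x: "x \<in> {0..T}"
          have "\<rho> ^ n * K * w i x \<le> \<rho> ^ n * K * B"
            using w(2)[OF x] K \<rho> by (intro mult_left_mono) auto
          with uS[OF x, of i n] elim show "dist (S n i x) (u i x) < e"
            by (simp add: dist_real_def ac_simps)
        qed
      qed
    qed
  qed simp
  show ?thesis
  proof
    fix i t assume t: "t \<in> {0..T}"
    have bound: "\<bar>F u i t - S (Suc n) i t\<bar> \<le> \<rho> ^ Suc n * (K * w i t)" for n
    proof -
      have "\<bar>F u i t - F (S n) i t\<bar> \<le> \<rho> * (\<rho> ^ n * K) * w i t"
        by (rule contr) (use uc Sc uS t K \<rho> in auto)
      then show ?thesis by (simp add: S_def ac_simps)
    qed
    have "(\<lambda>n. F u i t - S (Suc n) i t) \<longlonglongrightarrow> 0"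
    proof (rule Lim_null_comparison)
      show "\<forall>\<^sub>F n in sequentially. norm (F u i t - S (Suc n) i t) \<le> \<rho> ^ Suc n * (K * w i t)"
        using bound by (intro always_eventually) (auto simp del: power_Suc)
      show "(\<lambda>n. \<rho> ^ Suc n * (K * w i t)) \<longlonglongrightarrow> 0" by (rule LIMSEQ_Suc[OF lim0])
    qed
    moreover have "(\<lambda>n. F u i t - S (Suc n) i t) \<longlonglongrightarrow> F u i t - u i t"
      by (intro tendsto_intros LIMSEQ_Suc ulim t)
    ultimately show "F u i t = u i t" using LIMSEQ_unique by fastforce
  qed (rule uc)
qed

section \<open>The reflection problem\<close>

text \<open>The weights \<open>i (N - i)\<close> have second difference \<open>-2\<close>, which makes the discrete averaging
  operator with Dirichlet conditions a contraction in the weighted norm.\<close>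

definition concave_weight :: "nat \<Rightarrow> nat \<Rightarrow> real" where
  "concave_weight N i = (if i \<le> N then real i * real (N - i) else 0)"

lemma concave_weight_nonneg: "0 \<le> concave_weight N i"
  by (simp add: concave_weight_def)

lemma concave_weight_0 [simp]: "concave_weight N 0 = 0"
  by (simp add: concave_weight_def)

lemma concave_weight_N [simp]: "concave_weight N N = 0"
  by (simp add: concave_weight_def)

lemma concave_weight_le: "concave_weight N i \<le> (real N)\<^sup>2"
  by (auto simp: concave_weight_def power2_eq_square intro!: mult_mono)

lemma concave_weight_ge_1:
  assumes "1 \<le> i" "i < N"
  shows "1 \<le> concave_weight N i"
proof -
  have "1 * 1 \<le> real i * real (N - i)" using assms by (intro mult_mono) auto
  then show ?thesis using assms by (simp add: concave_weight_def)
qed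

lemma concave_weight_average:
  assumes "1 \<le> i" "i < N"
  shows "concave_weight N (i - 1) + concave_weight N (i + 1) = 2 * concave_weight N i - 2"
proof -
  obtain k where "i = Suc k" using assms by (cases i) auto
  then show ?thesis using assms by (simp add: concave_weight_def of_nat_diff algebra_simps)
qed

text \<open>Subtracting \<open>c\<close> times the weight, whose second difference is -2, absorbs
  the constant \<open>c\<close>. What remains lies below the average of its neighbours, so it cannot
  have a positive maximum inside.\<close>

lemma discrete_maximum_principle:
  fixes a :: "nat \<Rightarrow> real"
  assumes "\<And>i. 1 \<le> i \<Longrightarrow> i < N \<Longrightarrow> a i \<le> c + (a (i - 1) + a (i + 1)) / 2"
    and "a 0 \<le> 0" "a N \<le> 0" and i: "i \<le> N"
  shows "a i \<le> c * concave_weight N i"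
proof -
  define b where "b i = a i - c * concave_weight N i" for i
  have b: "b j \<le> (b (j - 1) + b (j + 1)) / 2" if "1 \<le> j" "j < N" for j
  proof -
    have "c * concave_weight N (j - 1) + c * concave_weight N (j + 1) = 2 * (c * concave_weight N j) - 2 * c"
      unfolding distrib_left[symmetric] concave_weight_average[OF that] by (simp add: algebra_simps)
    moreover have "p + q = 2 * s - 2 * c \<Longrightarrow> x \<le> c + (y + z) / 2 \<Longrightarrow> x - s \<le> ((y - p) + (z - q)) / 2"
      for p q s x y z :: real by (simp add: field_simps)
    ultimately show ?thesis using assms(1)[OF that] unfolding b_def by blast
  qed
  define m where "m = Max (b ` {..N})"
  have le: "b j \<le> m" if "j \<le> N" for j using that by (simp add: m_def)
  have "m \<in> b ` {..N}" unfolding m_def by (rule Max_in) auto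
  then have ex: "\<exists>j. j \<le> N \<and> b j = m" by auto
  \<comment> \<open>The leftmost maximiser has a strictly smaller left neighbour, which contradicts
    the averaging inequality.\<close>
  define j where "j = (LEAST j. j \<le> N \<and> b j = m)"
  have j: "j \<le> N" "b j = m" using LeastI_ex[OF ex] by (auto simp: j_def)
  have "m \<le> 0"
  proof (rule ccontr)
    assume "\<not> m \<le> 0"
    then have j1: "1 \<le> j" "j < N" using j assms(2,3) 
      by (auto simp: b_def not_less_eq_eq intro!: le_neq_implies_less Suc_leI gr0I)
    have "b (j - 1) \<noteq> m"
      using not_less_Least[of "j - 1" "\<lambda>j. j \<le> N \<and> b j = m"] j1 by (auto simp: j_def[symmetric])
    moreover have "b (j - 1) \<le> m" by (rule le) (use j1 in linarith)
    ultimately have "b (j - 1) < m" by simp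
    then show False using b[OF j1] le[of "j + 1"] j1 j by simp
  qed
  then show ?thesis using le[OF i] by (simp add: b_def)
qed

text \<open>Both unknowns form one family over \<open>nat + nat\<close>: \<open>Inl i\<close>
  carries \<open>L i\<close> and \<open>Inr i\<close> carries \<open>z i\<close>. The running
  maximum contracts through the concave weight, the integral equation through the exponential
  one.\<close>

lemma reflection_fixed_point:
  fixes g :: "real \<Rightarrow> real" and N :: nat
  assumes T: "T > 0" and r: "r \<ge> 0" and lip: "\<And>x y. \<bar>g x - g y\<bar> \<le> M * \<bar>x - y\<bar>"
  obtains z L where "\<And>i. continuous_on {0..T} (z i)" "\<And>i. continuous_on {0..T} (L i)"
    "\<And>t. t \<in> {0..T} \<Longrightarrow> L 0 t = 0" "\<And>t. t \<in> {0..T} \<Longrightarrow> L N t = 0"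
    "\<And>i t. i \<in> {1..N} \<Longrightarrow> t \<in> {0..T} \<Longrightarrow> z i t = x0 i - integral {0..t} (\<lambda>s. g (z i s - L i s + L (i - 1) s))"
    "\<And>i t. i \<in> {1..<N} \<Longrightarrow> t \<in> {0..T} \<Longrightarrow>
       L i t = running_max (\<lambda>s. (z i s - z (i + 1) s + 2 * r + L (i - 1) s + L (i + 1) s) / 2) t"
proof -
  have M: "M \<ge> 0" using lip[of 1 0] by simp
  have gc: "continuous_on A g" for A
    by (rule lipschitz_on_continuous_on[of M]) (use M lip in \<open>auto simp: lipschitz_on_def dist_real_def\<close>)
  define f where "f u i s = (u (Inr i) s - u (Inr (i + 1)) s + 2 * r + u (Inl (i - 1)) s + u (Inl (i + 1)) s) / 2"
    for u :: "nat + nat \<Rightarrow> real \<Rightarrow> real" and i s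
  define G where "G u i s = g (u (Inr i) s - u (Inl i) s + u (Inl (i - 1)) s)"
    for u :: "nat + nat \<Rightarrow> real \<Rightarrow> real" and i s
  \<comment> \<open>The value 0 outside the ranges enforces the boundary conditions for
    \<open>L 0\<close> and \<open>L N\<close>.\<close>
  define F where "F u k t = (case k of
      Inl (i::nat) \<Rightarrow> (if 1 \<le> i \<and> i < N then running_max (f u i) t else 0)
    | Inr (i::nat) \<Rightarrow> (if 1 \<le> i \<and> i \<le> N then x0 i - integral {0..t} (G u i) else 0))"
    for u :: "nat + nat \<Rightarrow> real \<Rightarrow> real" and k :: "nat + nat" and t
  define P where "P = (real N)\<^sup>2 + 1"
  have P: "P \<ge> 1" by (simp add: P_def)
  have cP: "concave_weight N i \<le> P" for i using concave_weight_le[of N i] by (simp add: P_def)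
  \<comment> \<open>Integrating the exponential weight gains \<open>1 / \<kappa>\<close>. This size
    brings the Lipschitz constant of the integral term down to \<open>D / 4\<close>, and the added 1
    keeps \<open>\<kappa>\<close> positive.\<close>
  define \<kappa> where "\<kappa> = 4 * M * (1/2 + 2 * P) + 1"
  have \<kappa>: "\<kappa> \<ge> 1" using M P by (simp add: \<kappa>_def)
  \<comment> \<open>The margin 1/2 left by the averaging, relative to the upper bound
    \<open>P\<close> of the weights: \<open>w - 1/2 \<le> \<rho> * w\<close> whenever
    \<open>w \<le> P\<close>.\<close>
  define \<rho> where "\<rho> = 1 - 1 / (2 * P)"
  have \<rho>: "1/2 \<le> \<rho>" "\<rho> < 1" using P by (auto simp: \<rho>_def field_simps)
  \<comment> \<open>With weight 1/2 for \<open>z\<close>, the two positions in \<open>f\<close>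
    contribute 1 before halving, which uses up only half of the second difference -2 of the concave
    weight.\<close>
  define \<omega> where "\<omega> k = (case k of Inl i \<Rightarrow> concave_weight N i | Inr i \<Rightarrow> 1/2)" for k :: "nat + nat"
  have \<omega>0: "0 \<le> \<omega> k" for k by (auto simp: \<omega>_def concave_weight_nonneg split: sum.split)
  have \<omega>P: "\<omega> k \<le> P" for k using P cP by (auto simp: \<omega>_def split: sum.split)
  \<comment> \<open>Bounds the first iterate, where \<open>L\<close> is the running maximum of the
    constant \<open>r\<close> and \<open>z i\<close> is \<open>x0 i - t * g 0\<close>; the factor 2
    compensates the weight 1/2.\<close>
  define D0 where "D0 = r + 2 * ((\<Sum>i\<le>N. \<bar>x0 i\<bar>) + T * \<bar>g 0\<bar>)"
  have fc: "continuous_on {0..T} (f u i)" if "\<And>k. continuous_on {0..T} (u k)" for u i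
    unfolding f_def by (intro continuous_intros that) auto
  have Gc: "continuous_on {0..T} (G u i)" if "\<And>k. continuous_on {0..T} (u k)" for u i
    unfolding G_def by (intro continuous_on_compose2[OF gc[of UNIV]] continuous_intros that) auto
  obtain u :: "nat + nat \<Rightarrow> real \<Rightarrow> real" where uc: "\<And>k. continuous_on {0..T} (u k)" and uF: "\<And>k t. t \<in> {0..T} \<Longrightarrow> F u k t = u k t"
  proof (rule weighted_contraction_fixed_point[of T F "\<lambda>k t. \<omega> k * exp (\<kappa> * t)" "P * exp (\<kappa> * T)" \<rho> D0])
    fix u :: "nat + nat \<Rightarrow> real \<Rightarrow> real" and k assume c: "\<And>k. continuous_on {0..T} (u k)"
    show "continuous_on {0..T} (F u k)"
    proof (cases k)
      case (Inl i)
      have "F u k = (if 1 \<le> i \<and> i < N then running_max (f u i) else (\<lambda>_. 0))"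
        by (auto simp: F_def Inl)
      then show ?thesis using running_max_continuous[OF fc[OF c]] by auto
    next
      case (Inr i)
      have "F u k = (if 1 \<le> i \<and> i \<le> N then (\<lambda>t. x0 i - integral {0..t} (G u i)) else (\<lambda>_. 0))"
        by (auto simp: F_def Inr)
      moreover have "continuous_on {0..T} (\<lambda>t. x0 i - integral {0..t} (G u i))"
        by (intro continuous_intros indefinite_integral_continuous_1 integrable_continuous_real Gc c)
      ultimately show ?thesis by auto
    qed
  next
    fix k t assume "t \<in> {0..T}"
    then show "\<omega> k * exp (\<kappa> * t) \<le> P * exp (\<kappa> * T)"
      using \<omega>P \<omega>0 P \<kappa> by (intro mult_mono) auto
  next
    fix u v :: "nat + nat \<Rightarrow> real \<Rightarrow> real" and D k t
    assume uc: "\<And>k. continuous_on {0..T} (u k)" and vc: "\<And>k. continuous_on {0..T} (v k)"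
      and D: "0 \<le> D" and uv: "\<And>k t. t \<in> {0..T} \<Longrightarrow> \<bar>u k t - v k t\<bar> \<le> D * (\<omega> k * exp (\<kappa> * t))"
      and t: "t \<in> {0..T}"
    show "\<bar>F u k t - F v k t\<bar> \<le> \<rho> * D * (\<omega> k * exp (\<kappa> * t))"
    proof (cases k)
      case (Inl i)
      show ?thesis
      proof (cases "1 \<le> i \<and> i < N")
        case True
        let ?w = "concave_weight N"
        have "\<bar>f u i s - f v i s\<bar> \<le> \<rho> * D * (?w i * exp (\<kappa> * t))" if s: "0 \<le> s" "s \<le> t" for s
        proof -
          have sT: "s \<in> {0..T}" using s t by auto
          define E where "E = exp (\<kappa> * s)"
          have "\<bar>f u i s - f v i s\<bar> \<le> (\<bar>u (Inr i) s - v (Inr i) s\<bar> + \<bar>u (Inr (i+1)) s - v (Inr (i+1)) s\<bar>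
             + \<bar>u (Inl (i-1)) s - v (Inl (i-1)) s\<bar> + \<bar>u (Inl (i+1)) s - v (Inl (i+1)) s\<bar>) / 2"
          proof -
            have "\<bar>(a - b + 2 * r + c + d) / 2 - (a' - b' + 2 * r + c' + d') / 2\<bar>
              \<le> (\<bar>a - a'\<bar> + \<bar>b - b'\<bar> + \<bar>c - c'\<bar> + \<bar>d - d'\<bar>) / 2" for a b c d a' b' c' d' :: real
            proof -
              have eq: "(a - b + 2 * r + c + d) / 2 - (a' - b' + 2 * r + c' + d') / 2
                = ((a - a') - (b - b') + (c - c') + (d - d')) / 2" by (simp add: field_simps)
              have "\<bar>x - y + z + w\<bar> \<le> \<bar>x\<bar> + \<bar>y\<bar> + \<bar>z\<bar> + \<bar>w\<bar>" for x y z w :: real by linarith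
              then show ?thesis unfolding eq abs_divide by simp
            qed
            then show ?thesis unfolding f_def .
          qed
          also have "\<dots> \<le> (D * (1/2 * E) + D * (1/2 * E) + D * (?w (i-1) * E) + D * (?w (i+1) * E)) / 2"
            using uv[OF sT, of "Inr i"] uv[OF sT, of "Inr (i+1)"] uv[OF sT, of "Inl (i-1)"] uv[OF sT, of "Inl (i+1)"]
            by (simp add: \<omega>_def E_def)
          also have "\<dots> = D * E * ((1 + (?w (i-1) + ?w (i+1))) / 2)"
            by (simp add: field_simps)
          also have "\<dots> = D * E * (?w i - 1/2)" 
            using True by (subst concave_weight_average) auto
          also have "\<dots> \<le> D * E * (\<rho> * ?w i)"
          proof (rule mult_left_mono)
            show "?w i - 1/2 \<le> \<rho> * ?w i" using cP[of i] P by (simp add: \<rho>_def field_simps)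
          qed (use D in \<open>simp add: E_def\<close>)
          also have "\<dots> \<le> D * exp (\<kappa> * t) * (\<rho> * ?w i)"
            using s \<kappa> D \<rho> concave_weight_nonneg[of N i] by (intro mult_right_mono mult_left_mono) (auto simp: E_def)
          finally show ?thesis by (simp add: ac_simps)
        qed
        then have "\<bar>running_max (f u i) t - running_max (f v i) t\<bar> \<le> \<rho> * D * (?w i * exp (\<kappa> * t))"
          using t by (intro running_max_diff_le[OF fc[OF uc] fc[OF vc]]) auto
        then show ?thesis using True by (simp add: F_def Inl \<omega>_def)
      next
        case False
        then show ?thesis using D \<rho> concave_weight_nonneg[of N i] by (auto simp: F_def Inl \<omega>_def)
      qed
    next
      case (Inr i)
      show ?thesis
      proof (cases "1 \<le> i \<and> i \<le> N")
        case True
        define C where "C = M * D * (1/2 + 2 * P)"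
        have C0: "C \<ge> 0" using M D P by (simp add: C_def)
        have sub: "{0..t} \<subseteq> {0..T}" using t by auto
        have int: "G u i integrable_on {0..t}" "G v i integrable_on {0..t}"
          by (intro integrable_continuous_real continuous_on_subset[OF Gc sub] uc vc)+
        have d: "\<bar>G u i s - G v i s\<bar> \<le> C * exp (\<kappa> * s)" if "s \<in> {0..t}" for s
        proof -
          have sT: "s \<in> {0..T}" using that t by auto
          define E where "E = exp (\<kappa> * s)"
          have "\<bar>G u i s - G v i s\<bar> \<le> M * \<bar>(u (Inr i) s - u (Inl i) s + u (Inl (i - 1)) s) - (v (Inr i) s - v (Inl i) s + v (Inl (i - 1)) s)\<bar>"
            unfolding G_def by (rule lip)
          also have "\<dots> \<le> M * (D * (1/2 * E) + D * (\<omega> (Inl i) * E) + D * (\<omega> (Inl (i-1)) * E))"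
          proof (rule mult_left_mono[OF _ M])
            have "\<bar>x - y + z - (x' - y' + z')\<bar> \<le> a + b + c"
              if "\<bar>x - x'\<bar> \<le> a" "\<bar>y - y'\<bar> \<le> b" "\<bar>z - z'\<bar> \<le> c" for x x' y y' z z' a b c :: real
              using that by linarith
            moreover have "\<bar>u (Inr i) s - v (Inr i) s\<bar> \<le> D * (1/2 * E)"
              using uv[OF sT, of "Inr i"] by (simp add: \<omega>_def E_def)
            ultimately show "\<bar>u (Inr i) s - u (Inl i) s + u (Inl (i - 1)) s - (v (Inr i) s - v (Inl i) s + v (Inl (i - 1)) s)\<bar>
              \<le> D * (1/2 * E) + D * (\<omega> (Inl i) * E) + D * (\<omega> (Inl (i-1)) * E)"
              using uv[OF sT] unfolding E_def by blast
          qed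
          also have "\<dots> = M * D * E * (1/2 + \<omega> (Inl i) + \<omega> (Inl (i-1)))" by (simp add: algebra_simps)
          also have "\<dots> \<le> M * D * E * (1/2 + 2 * P)"
            using \<omega>P[of "Inl i"] \<omega>P[of "Inl (i-1)"] M D by (intro mult_left_mono) (auto simp: E_def)
          finally show ?thesis by (simp add: C_def E_def ac_simps)
        qed
        have exp_int: "((\<lambda>s. C * exp (\<kappa> * s)) has_integral (C * exp (\<kappa> * t) / \<kappa> - C * exp (\<kappa> * 0) / \<kappa>)) {0..t}"
        proof (rule fundamental_theorem_of_calculus)
          fix x
          show "((\<lambda>t. C * exp (\<kappa> * t) / \<kappa>) has_vector_derivative C * exp (\<kappa> * x)) (at x within {0..t})"
            using \<kappa> by (auto intro!: derivative_eq_intros simp flip: has_real_derivative_iff_has_vector_derivative)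
        qed (use t in auto)
        have "\<bar>integral {0..t} (G u i) - integral {0..t} (G v i)\<bar> = norm (integral {0..t} (\<lambda>s. G u i s - G v i s))"
          using int by (simp add: Henstock_Kurzweil_Integration.integral_diff)
        also have "\<dots> \<le> integral {0..t} (\<lambda>s. C * exp (\<kappa> * s))"
          by (rule Henstock_Kurzweil_Integration.integral_norm_bound_integral)
            (use int d exp_int in \<open>auto intro: Henstock_Kurzweil_Integration.integrable_diff\<close>)
        also have "\<dots> = C * exp (\<kappa> * t) / \<kappa> - C * exp (\<kappa> * 0) / \<kappa>" using exp_int by (rule integral_unique)
        also have "\<dots> \<le> C * exp (\<kappa> * t) / \<kappa>" using C0 \<kappa> by simp
        also have "\<dots> = (C / \<kappa>) * exp (\<kappa> * t)" by simp
        also have "\<dots> \<le> (\<rho> * D * (1/2)) * exp (\<kappa> * t)"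
        proof (rule mult_right_mono)
          have "4 * C \<le> D * \<kappa>" using D by (simp add: C_def \<kappa>_def algebra_simps)
          then have "C / \<kappa> \<le> D / 4" using \<kappa> by (simp add: field_simps)
          also have "\<dots> \<le> \<rho> * D * (1/2)" using mult_right_mono[OF \<rho>(1) D] by simp
          finally show "C / \<kappa> \<le> \<rho> * D * (1/2)" .
        qed simp
        finally show ?thesis using True by (simp add: F_def Inr \<omega>_def abs_minus_commute)
      next
        case False
        then show ?thesis using D \<rho> by (auto simp: F_def Inr \<omega>_def)
      qed
    qed
  next
    show D0: "0 \<le> D0" using r T by (simp add: D0_def sum_nonneg)
    fix k t assume t: "t \<in> {0..T}"
    have e: "1 \<le> exp (\<kappa> * t)" using t \<kappa> by simp
    show "\<bar>F (\<lambda>_ _. 0) k t\<bar> \<le> D0 * (\<omega> k * exp (\<kappa> * t))"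
    proof (cases k)
      case (Inl i)
      show ?thesis
      proof (cases "1 \<le> i \<and> i < N")
        case True
        have f0: "f (\<lambda>_ _. 0) i = (\<lambda>_. r)" by (rule ext) (simp add: f_def)
        have "0 \<le> running_max (\<lambda>_. r) t" "running_max (\<lambda>_. r) t \<le> r"
          using t r by (auto intro!: running_max_upper(2)[where s=t and T=T] running_max_least[where T=T])
        moreover have "r * 1 \<le> D0 * (\<omega> k * exp (\<kappa> * t))"
        proof (rule mult_mono)
          show "r \<le> D0" using T by (simp add: D0_def sum_nonneg)
          have "1 * 1 \<le> \<omega> k * exp (\<kappa> * t)"
            using True e concave_weight_ge_1[of i N] by (intro mult_mono) (auto simp: \<omega>_def Inl)
          then show "1 \<le> \<omega> k * exp (\<kappa> * t)" by simp
        qed (use r D0 in auto)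
        ultimately show ?thesis using True by (simp add: F_def Inl f0)
      next
        case False
        then show ?thesis using D0 concave_weight_nonneg[of N i] by (auto simp: F_def Inl \<omega>_def)
      qed
    next
      case (Inr i)
      show ?thesis
      proof (cases "1 \<le> i \<and> i \<le> N")
        case True
        have "integral {0..t} (G (\<lambda>_ _. 0) i) = t * g 0" using t by (simp add: G_def[abs_def])
        then have "\<bar>F (\<lambda>_ _. 0) k t\<bar> \<le> \<bar>x0 i\<bar> + t * \<bar>g 0\<bar>"
          using True t abs_triangle_ineq4[of "x0 i" "t * g 0"] by (simp add: F_def Inr abs_mult)
        also have "\<dots> \<le> (\<Sum>i\<le>N. \<bar>x0 i\<bar>) + T * \<bar>g 0\<bar>"
          using True t by (intro add_mono mult_right_mono member_le_sum) auto
        also have "\<dots> \<le> D0 * \<omega> k * 1" using r by (simp add: D0_def \<omega>_def Inr)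
        also have "\<dots> \<le> D0 * \<omega> k * exp (\<kappa> * t)"
          using e D0 \<omega>0 by (intro mult_left_mono) auto
        finally show ?thesis by (simp add: ac_simps)
      next
        case False
        then show ?thesis using D0 by (auto simp: F_def Inr \<omega>_def)
      qed
    qed
  qed (use \<rho> \<omega>0 in auto)
  show ?thesis
  proof (rule that[of "\<lambda>i. u (Inr i)" "\<lambda>i. u (Inl i)"])
    show "u (Inl 0) t = 0" "u (Inl N) t = 0" if "t \<in> {0..T}" for t
      using uF[OF that, of "Inl 0"] uF[OF that, of "Inl N"] by (auto simp: F_def)
    show "u (Inr i) t = x0 i - integral {0..t} (\<lambda>s. g (u (Inr i) s - u (Inl i) s + u (Inl (i - 1)) s))"
      if "i \<in> {1..N}" "t \<in> {0..T}" for i t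
      using uF[OF that(2), of "Inr i"] that by (simp add: F_def G_def[abs_def])
    show "u (Inl i) t = running_max (\<lambda>s. (u (Inr i) s - u (Inr (i + 1)) s + 2 * r + u (Inl (i - 1)) s + u (Inl (i + 1)) s) / 2) t"
      if "i \<in> {1..<N}" "t \<in> {0..T}" for i t
      using uF[OF that(2), of "Inl i"] that by (simp add: F_def f_def[abs_def])
  qed (rule uc)+
qed

text \<open>On time windows of bounded length, the largest increment of \<open>L j\<close> exceeds
  the average of those of its neighbours by at most the increment of \<open>z\<close>. The maximum
  principle then resolves this coupled system of inequalities.\<close>

lemma reflection_lipschitz:
  fixes N :: nat
  assumes zc: "\<And>i. continuous_on {0..T} (z i)" and Lc: "\<And>i. continuous_on {0..T} (L i)"
    and L0: "\<And>t. t \<in> {0..T} \<Longrightarrow> L 0 t = 0" "\<And>t. t \<in> {0..T} \<Longrightarrow> L N t = 0"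
    and L: "\<And>i t. i \<in> {1..<N} \<Longrightarrow> t \<in> {0..T} \<Longrightarrow>
       L i t = running_max (\<lambda>s. (z i s - z (i + 1) s + 2 * r + L (i - 1) s + L (i + 1) s) / 2) t"
    and zlip: "\<And>i s t. i \<in> {1..N} \<Longrightarrow> 0 \<le> s \<Longrightarrow> s \<le> t \<Longrightarrow> t \<le> T \<Longrightarrow> \<bar>z i t - z i s\<bar> \<le> K * (t - s)"
    and K: "0 \<le> K" and i: "i \<le> N" and st: "0 \<le> s" "s \<le> t" "t \<le> T"
  shows "L i t - L i s \<le> K * (t - s) * concave_weight N i"
proof -
  define h where "h = t - s"
  \<comment> \<open>All windows of length at most \<open>h\<close>, not only \<open>(s, t)\<close>:
    the increment of a running maximum involves \<open>f\<close> at intermediate times, so shortened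
    windows must belong to the family.\<close>
  define A where "A = {(a, b). 0 \<le> a \<and> a \<le> b \<and> b \<le> T \<and> b - a \<le> h}"
  have A: "(s, t) \<in> A" using st by (simp add: A_def h_def)
  define d where "d j = (SUP (a, b)\<in>A. L j b - L j a)" for j
  have bdd: "bdd_above ((\<lambda>(a, b). L j b - L j a) ` A)" for j
  proof -
    have "bounded (L j ` {0..T})"
      by (intro compact_imp_bounded compact_continuous_image Lc) simp
    then obtain B where "\<forall>x\<in>{0..T}. \<bar>L j x\<bar> \<le> B" by (auto simp: bounded_iff)
    then have B: "\<bar>L j x\<bar> \<le> B" if "x \<in> {0..T}" for x using that by blast
    show ?thesis
    proof (rule bdd_aboveI2)
      fix p assume "p \<in> A"
      then show "(case p of (a, b) \<Rightarrow> L j b - L j a) \<le> B + B"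
        using B[of "fst p"] B[of "snd p"] by (auto simp: A_def)
    qed
  qed
  have upper: "L j b - L j a \<le> d j" if "(a, b) \<in> A" for a b j
    unfolding d_def using cSUP_upper[OF that bdd[of j]] by simp
  have "d i \<le> (K * h) * concave_weight N i"
  proof (rule discrete_maximum_principle[OF _ _ _ i])
    fix j assume j: "1 \<le> j" "j < N"
    define f where "f s = (z j s - z (j + 1) s + 2 * r + L (j - 1) s + L (j + 1) s) / 2" for s
    have fc: "continuous_on {0..T} f" unfolding f_def by (intro continuous_intros zc Lc) auto
    have Lf: "L j t = running_max f t" if "t \<in> {0..T}" for t
      unfolding f_def[abs_def] by (rule L) (use j that in auto)
    show "d j \<le> K * h + (d (j - 1) + d (j + 1)) / 2"
      unfolding d_def[of j]
    proof (rule cSUP_least)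
      fix p assume "p \<in> A"
      then obtain a b where p: "p = (a, b)" "(a, b) \<in> A" by (cases p) auto
      then have ab: "0 \<le> a" "a \<le> b" "b \<le> T" "b - a \<le> h" by (auto simp: A_def)
      have "running_max f b - running_max f a \<le> K * h + (d (j - 1) + d (j + 1)) / 2"
      proof (rule running_max_increment[OF fc])
        fix u assume u: "a \<le> u" "u \<le> b"
        then have "(a, u) \<in> A" using ab by (auto simp: A_def)
        then have 1: "L (j - 1) u - L (j - 1) a \<le> d (j - 1)" "L (j + 1) u - L (j + 1) a \<le> d (j + 1)"
          by (auto intro: upper)
        have "K * (u - a) \<le> K * h" using u ab K by (intro mult_left_mono) auto
        then have 2: "\<bar>z j u - z j a\<bar> \<le> K * h" "\<bar>z (j + 1) u - z (j + 1) a\<bar> \<le> K * h"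
          using zlip[of j a u] zlip[of "j + 1" a u] j u ab by auto
        have "x' - x \<le> c \<Longrightarrow> y' - y \<le> e \<Longrightarrow> \<bar>p' - p\<bar> \<le> C \<Longrightarrow> \<bar>q' - q\<bar> \<le> C \<Longrightarrow>
          (p' - q' + 2 * r + x' + y') / 2 - (p - q + 2 * r + x + y) / 2 \<le> C + (c + e) / 2"
          for x x' y y' c e p p' q q' C :: real by (simp add: field_simps abs_le_iff)
        from this[OF 1 2] show "f u - f a \<le> K * h + (d (j - 1) + d (j + 1)) / 2"
          unfolding f_def .
      qed (use ab in auto)
      then show "(case p of (a, b) \<Rightarrow> L j b - L j a) \<le> K * h + (d (j - 1) + d (j + 1)) / 2"
        using ab by (simp add: p Lf)
    qed (use A in auto)
  next
    have "d 0 \<le> 0" unfolding d_def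
      by (rule cSUP_least) (use A L0(1) in \<open>auto simp: A_def\<close>)
    then show "d 0 \<le> 0" .
    show "d N \<le> 0" unfolding d_def
      by (rule cSUP_least) (use A L0(2) in \<open>auto simp: A_def\<close>)
  qed
  with upper[OF A, of i] show ?thesis by (simp add: h_def)
qed

text \<open>The fixed point restated for the positions. The last clause is complementarity before
  any multiplier exists: around a time with an open gap, \<open>L i\<close> is constant on an
  interval with rational endpoints.\<close>

lemma reflected_flow_exists:
  fixes g :: "real \<Rightarrow> real" and N :: nat
  assumes T: "T > 0" and r: "r \<ge> 0" and lip: "\<And>x y. \<bar>g x - g y\<bar> \<le> M * \<bar>x - y\<bar>"
    and x0: "\<And>i. i \<in> {1..<N} \<Longrightarrow> x0 (i + 1) - x0 i \<ge> 2 * r"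
  obtains X L C where "\<And>i. continuous_on {0..T} (X i)" 
    "\<And>i. i \<in> {1..N} \<Longrightarrow> X i 0 = x0 i"
    "\<And>t. t \<in> {0..T} \<Longrightarrow> L 0 t = 0" "\<And>t. t \<in> {0..T} \<Longrightarrow> L N t = 0"
    "\<And>i. i \<le> N \<Longrightarrow> L i 0 = 0"
    "\<And>i s t. i \<le> N \<Longrightarrow> 0 \<le> s \<Longrightarrow> s \<le> t \<Longrightarrow> t \<le> T \<Longrightarrow> L i s \<le> L i t \<and> L i t - L i s \<le> C * (t - s)"
    "\<And>i t. i \<in> {1..N} \<Longrightarrow> t \<in> {0..T} \<Longrightarrow> X i t = x0 i - integral {0..t} (\<lambda>s. g (X i s)) - L i t + L (i - 1) t"
    "\<And>i t. i \<in> {1..<N} \<Longrightarrow> t \<in> {0..T} \<Longrightarrow> X (i + 1) t - X i t \<ge> 2 * r"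
    "\<And>i t. i \<in> {1..<N} \<Longrightarrow> 0 < t \<Longrightarrow> t < T \<Longrightarrow> X (i + 1) t - X i t > 2 * r \<Longrightarrow>
       \<exists>a b. a \<in> \<rat> \<and> b \<in> \<rat> \<and> 0 \<le> a \<and> a < t \<and> t < b \<and> b \<le> T \<and> L i a = L i b"
proof -
  have M: "M \<ge> 0" using lip[of 1 0] by simp
  have gc: "continuous_on A g" for A
    by (rule lipschitz_on_continuous_on[of M]) (use M lip in \<open>auto simp: lipschitz_on_def dist_real_def\<close>)
  obtain z L where zc: "\<And>i. continuous_on {0..T} (z i)" and Lc: "\<And>i. continuous_on {0..T} (L i)"
    and L0: "\<And>t. t \<in> {0..T} \<Longrightarrow> L 0 t = 0" "\<And>t. t \<in> {0..T} \<Longrightarrow> L N t = 0"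
    and z: "\<And>i t. i \<in> {1..N} \<Longrightarrow> t \<in> {0..T} \<Longrightarrow> z i t = x0 i - integral {0..t} (\<lambda>s. g (z i s - L i s + L (i - 1) s))"
    and L: "\<And>i t. i \<in> {1..<N} \<Longrightarrow> t \<in> {0..T} \<Longrightarrow>
       L i t = running_max (\<lambda>s. (z i s - z (i + 1) s + 2 * r + L (i - 1) s + L (i + 1) s) / 2) t"
    using reflection_fixed_point[OF T r lip, where N=N and ?x0.0=x0] by blast
  define f where "f i s = (z i s - z (i + 1) s + 2 * r + L (i - 1) s + L (i + 1) s) / 2" for i s
  have fc: "continuous_on {0..T} (f i)" for i unfolding f_def by (intro continuous_intros zc Lc) auto
  have Lf: "L i t = running_max (f i) t" if "i \<in> {1..<N}" "t \<in> {0..T}" for i t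
    unfolding f_def[abs_def] by (rule L[OF that])
  define X where "X i t = z i t - L i t + L (i - 1) t" for i t
  have Xc: "continuous_on {0..T} (X i)" for i unfolding X_def by (intro continuous_intros zc Lc)
  have gXc: "continuous_on {0..T} (\<lambda>s. g (X i s))" for i
    by (rule continuous_on_compose2[OF gc[of UNIV] Xc]) auto
  \<comment> \<open>The gap measures how far the running maximum lies above \<open>f\<close>. So
    non-overlapping is the majorant property, and an open gap means that the maximum is not attained
    at \<open>t\<close>.\<close>
  have gap: "X (i + 1) t - X i t - 2 * r = 2 * (L i t - f i t)" for i t
    by (simp add: X_def f_def field_simps)
  have "\<exists>B. \<forall>t\<in>{0..T}. \<bar>g (X i t)\<bar> \<le> B" for i
  proof -
    have "bounded ((\<lambda>s. g (X i s)) ` {0..T})"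
      by (intro compact_imp_bounded compact_continuous_image gXc) simp
    then show ?thesis by (auto simp: bounded_iff)
  qed
  then obtain B where B: "\<And>i t. t \<in> {0..T} \<Longrightarrow> \<bar>g (X i t)\<bar> \<le> B i" by metis
  have B0: "0 \<le> B i" for i using B[of 0 i] T by auto
  define K where "K = (\<Sum>i\<le>N. B i)"
  have K: "0 \<le> K" using B0 by (simp add: K_def sum_nonneg)
  have BK: "B i \<le> K" if "i \<le> N" for i unfolding K_def using that B0 by (intro member_le_sum) auto
  have zlip: "\<bar>z i t - z i s\<bar> \<le> K * (t - s)" if "i \<in> {1..N}" "0 \<le> s" "s \<le> t" "t \<le> T" for i s t
  proof -
    have "integral {0..s} (\<lambda>u. g (X i u)) + integral {s..t} (\<lambda>u. g (X i u)) = integral {0..t} (\<lambda>u. g (X i u))"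
      by (rule Henstock_Kurzweil_Integration.integral_combine)
        (use that in \<open>auto intro!: integrable_continuous_real continuous_on_subset[OF gXc]\<close>)
    then have "z i t - z i s = - integral {s..t} (\<lambda>u. g (X i u))"
      using z[of i t] z[of i s] that by (simp add: X_def)
    then have "\<bar>z i t - z i s\<bar> = norm (integral {s..t} (\<lambda>u. g (X i u)))" by simp
    also have "\<dots> \<le> K * (t - s)"
      by (rule integral_bound) (use that B BK in \<open>auto intro!: continuous_on_subset[OF gXc] order_trans[OF B BK]\<close>)
    finally show ?thesis .
  qed
  \<comment> \<open>At time 0 the values of \<open>L\<close> are still coupled. The initial spacing
    makes the \<open>z\<close> part of \<open>f\<close> nonpositive, so \<open>L j 0\<close> is at
    most the average of its neighbours, and the maximum principle applies with constant 0.\<close>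
  have Linit: "L i 0 \<le> 0 * concave_weight N i" if "i \<le> N" for i
  proof (rule discrete_maximum_principle[OF _ _ _ that])
    fix j assume j: "1 \<le> j" "j < N"
    have nn: "0 \<le> L k 0" if "k \<le> N" for k
    proof (cases "1 \<le> k \<and> k < N")
      case True
      then show ?thesis using running_max_upper(2)[OF fc, of 0 0 k] Lf[of k 0] T by simp
    next
      case False
      then have "k = 0 \<or> k = N" using that by auto
      then show ?thesis using L0[of 0] T by auto
    qed
    have "L j 0 = running_max (f j) 0" using Lf j T by simp
    also have "\<dots> \<le> 0 + (L (j - 1) 0 + L (j + 1) 0) / 2"
    proof (rule running_max_least[OF fc])
      show "0 \<le> 0 + (L (j - 1) 0 + L (j + 1) 0) / 2" using nn[of "j - 1"] nn[of "j + 1"] j by simp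
      fix s :: real assume s: "0 \<le> s" "s \<le> 0"
      have "z j 0 - z (j + 1) 0 + 2 * r \<le> 0" using z[of j 0] z[of "j + 1" 0] x0[of j] j T by simp
      moreover have "a + 2 * r \<le> 0 \<Longrightarrow> (a + 2 * r + x + y) / 2 \<le> 0 + (x + y) / 2" for a x y :: real
        by (simp add: field_simps)
      ultimately have "f j 0 \<le> 0 + (L (j - 1) 0 + L (j + 1) 0) / 2" unfolding f_def by blast
      then show "f j s \<le> 0 + (L (j - 1) 0 + L (j + 1) 0) / 2" using s by simp
    qed simp
    finally show "L j 0 \<le> 0 + (L (j - 1) 0 + L (j + 1) 0) / 2" .
  qed (use L0[of 0] T in auto)
  have mono: "L i s \<le> L i t" if "i \<le> N" "0 \<le> s" "s \<le> t" "t \<le> T" for i s t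
  proof (cases "1 \<le> i \<and> i < N")
    case True
    then show ?thesis using running_max_mono[OF fc, of s t i] Lf[of i] that by simp
  next
    case False
    then have "i = 0 \<or> i = N" using that by auto
    then show ?thesis using L0[of s] L0[of t] that by auto
  qed
  have Lz: "L i 0 = 0" if "i \<le> N" for i
  proof (cases "1 \<le> i \<and> i < N")
    case True
    then show ?thesis using running_max_upper(2)[OF fc, of 0 0 i] Lf[of i 0] T Linit[OF that] by simp
  next
    case False
    then have "i = 0 \<or> i = N" using that by auto
    then show ?thesis using L0[of 0] T by auto
  qed
  show ?thesis
  proof (rule that[of X L "K * (real N)\<^sup>2"])
    show "X i 0 = x0 i" if "i \<in> {1..N}" for i
    proof -
      have "i - 1 \<le> N" using that by auto
      then show ?thesis using z[of i 0] Lz[of i] Lz[of "i - 1"] that T by (simp add: X_def)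
    qed
    show "L i s \<le> L i t \<and> L i t - L i s \<le> K * (real N)\<^sup>2 * (t - s)"
      if st: "i \<le> N" "0 \<le> s" "s \<le> t" "t \<le> T" for i s t
    proof
      have "L i t - L i s \<le> K * (t - s) * concave_weight N i"
        by (rule reflection_lipschitz[OF zc Lc L0 L zlip K st])
      also have "\<dots> \<le> K * (t - s) * (real N)\<^sup>2"
        using K st by (intro mult_left_mono concave_weight_le) auto
      finally show "L i t - L i s \<le> K * (real N)\<^sup>2 * (t - s)" by (simp add: ac_simps)
    qed (rule mono[OF st])
    show "X i t = x0 i - integral {0..t} (\<lambda>s. g (X i s)) - L i t + L (i - 1) t" if "i \<in> {1..N}" "t \<in> {0..T}" for i t
      using z[OF that] by (simp add: X_def)
    show "X (i + 1) t - X i t \<ge> 2 * r" if "i \<in> {1..<N}" "t \<in> {0..T}" for i t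
      using gap[of i t] running_max_upper(1)[OF fc, of t t i] Lf[OF that] that by simp
    show "\<exists>a b. a \<in> \<rat> \<and> b \<in> \<rat> \<and> 0 \<le> a \<and> a < t \<and> t < b \<and> b \<le> T \<and> L i a = L i b"
      if i: "i \<in> {1..<N}" and t: "0 < t" "t < T" and g: "X (i + 1) t - X i t > 2 * r" for i t
    proof -
      have "f i t < running_max (f i) t" using gap[of i t] g Lf[OF i, of t] t by simp
      then obtain a b where "a \<in> \<rat>" "b \<in> \<rat>" "0 \<le> a" "a < t" "t < b" "b \<le> T" "running_max (f i) a = running_max (f i) b"
        using running_max_locally_constant[OF fc t] by blast
      moreover from this have "L i a = L i b" using Lf[OF i, of a] Lf[OF i, of b] t by simp
      ultimately show ?thesis by blast
    qed
  qed (use Xc L0 Lz in auto)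
qed

section \<open>Existence\<close>

lemma AE_lebesgue_on_Icc_iff_Ioo:
  fixes a b :: real
  shows "(AE t in lebesgue_on {a..b}. P t) \<longleftrightarrow> (AE t in lebesgue_on {a<..<b}. P t)"
proof -
  have "AE t in lebesgue. t \<noteq> a \<and> t \<noteq> b"
    using AE_completion[OF AE_lborel_singleton[of a]] AE_completion[OF AE_lborel_singleton[of b]]
    by eventually_elim simp
  then have "(AE t in lebesgue. t \<in> {a..b} \<longrightarrow> P t) \<longleftrightarrow> (AE t in lebesgue. t \<in> {a<..<b} \<longrightarrow> P t)"
    by (intro eventually_subst) (auto elim: eventually_mono)
  then show ?thesis by (simp add: AE_restrict_space_iff)
qed

text \<open>Clamping time to \<open>[0,T]\<close> is nondecreasing and 1-Lipschitz, so
  \<open>L\<close> extends to the line with the same constant.\<close>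

lemma lipschitz_mono_has_density_Icc:
  fixes L :: "real \<Rightarrow> real"
  assumes T: "0 \<le> T" and C: "0 \<le> C"
    and L: "\<And>s t. 0 \<le> s \<Longrightarrow> s \<le> t \<Longrightarrow> t \<le> T \<Longrightarrow> L s \<le> L t \<and> L t - L s \<le> C * (t - s)"
  obtains l where "l \<in> borel_measurable borel" "\<And>t. 0 \<le> l t" "\<And>t. l t \<le> C"
    "\<And>a b. 0 \<le> a \<Longrightarrow> a \<le> b \<Longrightarrow> b \<le> T \<Longrightarrow> (l has_integral (L b - L a)) {a..b}"
proof -
  define c where "c t = max 0 (min t T)" for t
  have c: "0 \<le> c s" "c s \<le> c t" "c t \<le> T" "c t - c s \<le> t - s" if "s \<le> t" for s t
    using that T by (auto simp: c_def)
  obtain l where l: "l \<in> borel_measurable borel" "\<And>t. 0 \<le> l t" "\<And>t. l t \<le> C"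
    "\<And>a b. a \<le> b \<Longrightarrow> (l has_integral (L (c b) - L (c a))) {a..b}"
  proof (rule lipschitz_mono_has_density[of "\<lambda>t. L (c t)" C])
    fix s t :: real assume st: "s \<le> t"
    show "L (c s) \<le> L (c t)" using L[OF c(1-3)[OF st]] by simp
    have "L (c t) - L (c s) \<le> C * (c t - c s)" using L[OF c(1-3)[OF st]] by simp
    also have "\<dots> \<le> C * (t - s)" by (rule mult_left_mono[OF c(4)[OF st] C])
    finally show "L (c t) - L (c s) \<le> C * (t - s)" .
  qed blast
  show ?thesis
  proof (rule that[OF l(1-3)])
    fix a b assume "0 \<le> a" "a \<le> b" "b \<le> T"
    then show "(l has_integral (L b - L a)) {a..b}" using l(4)[of a b] by (simp add: c_def)
  qed
qed

lemma AE_zero_of_nonneg_has_integral_0: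
  fixes l :: "real \<Rightarrow> real"
  assumes l: "l \<in> borel_measurable borel" "\<And>t. 0 \<le> l t" and int: "(l has_integral 0) {a..b}"
  shows "AE t in lebesgue. t \<in> {a..b} \<longrightarrow> l t = 0"
proof -
  have "l absolutely_integrable_on {a..b}"
    using int l(2) by (intro nonnegative_absolutely_integrable_1) auto
  then have i: "integrable (lebesgue_on {a..b}) l"
    by (simp add: absolutely_integrable_imp_integrable)
  have "(LINT t|lebesgue_on {a..b}. l t) = 0"
    using lebesgue_integral_eq_integral[OF i] int by (simp add: integral_unique)
  then have "AE t in lebesgue_on {a..b}. l t = 0"
    using integral_nonneg_eq_0_iff_AE[OF i] l(2) by simp
  then show ?thesis by (simp add: AE_restrict_space_iff)
qed

lemma solution_exists:
  fixes T r :: real and \<phi> :: "real \<Rightarrow> real" and N :: nat and x0 :: "nat \<Rightarrow> real"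
  assumes T: "T > 0" and r: "r \<ge> 0" and lip: "\<And>x y. \<bar>deriv \<phi> x - deriv \<phi> y\<bar> \<le> K * \<bar>x - y\<bar>"
    and x0: "\<And>i. i \<in> {1..<N} \<Longrightarrow> x0 (i + 1) - x0 i \<ge> 2 * r"
  shows "\<exists>X \<Lambda>. is_solution T \<phi> r N x0 X \<Lambda>"
proof -
  have K: "K \<ge> 0" using lip[of 1 0] by simp
  have gc: "continuous_on A (deriv \<phi>)" for A
    by (rule lipschitz_on_continuous_on[of K]) (use K lip in \<open>auto simp: lipschitz_on_def dist_real_def\<close>)
  obtain X L C where Xc: "\<And>i. continuous_on {0..T} (X i)" 
    and X0: "\<And>i. i \<in> {1..N} \<Longrightarrow> X i 0 = x0 i"
    and LN: "\<And>t. t \<in> {0..T} \<Longrightarrow> L 0 t = 0" "\<And>t. t \<in> {0..T} \<Longrightarrow> L N t = 0"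
    and L0: "\<And>i. i \<le> N \<Longrightarrow> L i 0 = 0"
    and Llip: "\<And>i s t. i \<le> N \<Longrightarrow> 0 \<le> s \<Longrightarrow> s \<le> t \<Longrightarrow> t \<le> T \<Longrightarrow> L i s \<le> L i t \<and> L i t - L i s \<le> C * (t - s)"
    and X: "\<And>i t. i \<in> {1..N} \<Longrightarrow> t \<in> {0..T} \<Longrightarrow>
      X i t = x0 i - integral {0..t} (\<lambda>s. deriv \<phi> (X i s)) - L i t + L (i - 1) t"
    and gap: "\<And>i t. i \<in> {1..<N} \<Longrightarrow> t \<in> {0..T} \<Longrightarrow> X (i + 1) t - X i t \<ge> 2 * r"
    and flat: "\<And>i t. i \<in> {1..<N} \<Longrightarrow> 0 < t \<Longrightarrow> t < T \<Longrightarrow> X (i + 1) t - X i t > 2 * r \<Longrightarrow>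
       \<exists>a b. a \<in> \<rat> \<and> b \<in> \<rat> \<and> 0 \<le> a \<and> a < t \<and> t < b \<and> b \<le> T \<and> L i a = L i b"
    using reflected_flow_exists[where g="deriv \<phi>" and ?x0.0=x0, OF T r lip x0] by blast
  have C: "0 \<le> C"
  proof -
    have "0 \<le> C * T" using Llip[of 0 0 T] T by auto
    then show ?thesis using T by (simp add: zero_le_mult_iff)
  qed
  \<comment> \<open>At the two ends the density is chosen to be literally 0, not just almost
    everywhere.\<close>
  have "\<exists>l. i \<le> N \<longrightarrow> l \<in> borel_measurable borel \<and> (\<forall>t. 0 \<le> l t \<and> l t \<le> C) \<and>
    (\<forall>a b. 0 \<le> a \<longrightarrow> a \<le> b \<longrightarrow> b \<le> T \<longrightarrow> (l has_integral (L i b - L i a)) {a..b}) \<and>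
    (i = 0 \<or> i = N \<longrightarrow> l = (\<lambda>_. 0))" for i
  proof (cases "i = 0 \<or> i = N")
    case True
    then show ?thesis using LN C by (intro exI[of _ "\<lambda>_. 0"]) auto
  next
    case False
    show ?thesis
    proof (cases "i \<le> N")
      case True
      obtain l where "l \<in> borel_measurable borel" "\<And>t. 0 \<le> l t" "\<And>t. l t \<le> C"
        "\<And>a b. 0 \<le> a \<Longrightarrow> a \<le> b \<Longrightarrow> b \<le> T \<Longrightarrow> (l has_integral (L i b - L i a)) {a..b}"
        using lipschitz_mono_has_density_Icc[of T C "L i"] T C Llip[OF True] by (metis less_imp_le)
      then show ?thesis using False by blast
    qed simp
  qed
  then obtain l where lm: "\<And>i. i \<le> N \<Longrightarrow> l i \<in> borel_measurable borel"
    and l0: "\<And>i t. i \<le> N \<Longrightarrow> 0 \<le> l i t" and lC: "\<And>i t. i \<le> N \<Longrightarrow> l i t \<le> C"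
    and lint: "\<And>i a b. i \<le> N \<Longrightarrow> 0 \<le> a \<Longrightarrow> a \<le> b \<Longrightarrow> b \<le> T \<Longrightarrow> (l i has_integral (L i b - L i a)) {a..b}"
    and lN: "l 0 = (\<lambda>_. 0)" "l N = (\<lambda>_. 0)"
    by (metis le0 order.refl)
  \<comment> \<open>\<open>l i\<close> is the density of \<open>L i\<close>, hence the force
    \<open>N\<close> times the multiplier.\<close>
  define \<Lambda> where "\<Lambda> t i = l i t / real N" for t i
  define V where "V i t = - deriv \<phi> (X i t) - real N * (\<Lambda> t i - \<Lambda> t (i - 1))" for i t
  have lmes: "l i \<in> borel_measurable (lebesgue_on {0<..<T})" if "i \<le> N" for i
    using lm[OF that] by (intro measurable_restrict_space1 measurable_completion) simp
  have lL2: "l i \<in> L2 T" if "i \<le> N" for i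
    by (rule L2_bounded[OF lmes[OF that], of C]) (use l0[OF that] lC[OF that] in auto)
  have gXc: "continuous_on {0..T} (\<lambda>s. - deriv \<phi> (X i s))" for i
    by (intro continuous_intros continuous_on_compose2[OF gc[of UNIV] Xc]) auto
  have weak: "has_weak_deriv T (X i) (V i)" if i: "i \<in> {1..N}" for i
  proof -
    have iN: "i \<le> N" "i - 1 \<le> N" using i by auto
    have V: "V i = (\<lambda>t. (- deriv \<phi> (X i t) - l i t) - (0 - l (i - 1) t))"
      using i by (auto simp: V_def \<Lambda>_def field_simps)
    have "(\<lambda>_. 0) \<in> L2 T" by (rule L2_continuous) auto
    then have VL2: "V i \<in> L2 T"
      unfolding V by (intro L2_diff L2_continuous[OF gXc] lL2 iN)
    have p: "X i t = x0 i + primitive T (V i) t" if t: "t \<in> {0..T}" for t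
    proof -
      have "((\<lambda>s. - deriv \<phi> (X i s)) has_integral integral {0..t} (\<lambda>s. - deriv \<phi> (X i s))) {0..t}"
        using t by (intro integrable_integral integrable_continuous_real continuous_on_subset[OF gXc]) auto
      then have "(V i has_integral (integral {0..t} (\<lambda>s. - deriv \<phi> (X i s)) - (L i t - L i 0)) - (0 - (L (i - 1) t - L (i - 1) 0))) {0..t}"
        unfolding V using t iN by (intro has_integral_diff lint has_integral_0) auto
      moreover have "primitive T (V i) t = integral {0..t} (V i)"
        by (rule primitive_eq_integral(2)[OF L2_imp_integrable[OF VL2] t])
      ultimately show ?thesis using X[OF i t] L0[OF iN(1)] L0[OF iN(2)] by (simp add: integral_unique)
    qed
    show ?thesis by (rule has_weak_deriv_primitive[OF T VL2 p])
  qed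
  have compl: "AE t in lebesgue_on {0..T}. \<Lambda> t i \<ge> 0 \<and> \<Lambda> t i * (X (i + 1) t - X i t - 2 * r) = 0"
    if i: "i \<in> {1..<N}" for i
  proof -
    have iN: "i \<le> N" using i by auto
    \<comment> \<open>On each interval of constancy the nonnegative density has integral 0 and
      vanishes almost everywhere. Rational endpoints leave only countably many exceptional null
      sets.\<close>
    define Q where "Q = {(a, b). a \<in> \<rat> \<and> b \<in> \<rat> \<and> 0 \<le> a \<and> a \<le> b \<and> b \<le> T \<and> L i a = L i b}"
    have "countable Q"
      by (rule countable_subset[of _ "\<rat> \<times> \<rat>"]) (auto simp: Q_def countable_rat)
    moreover have "AE t in lebesgue. t \<in> {fst p..snd p} \<longrightarrow> l i t = 0" if "p \<in> Q" for p
    proof (rule AE_zero_of_nonneg_has_integral_0[OF lm[OF iN] l0[OF iN]])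
      show "(l i has_integral 0) {fst p..snd p}"
        using that lint[OF iN, of "fst p" "snd p"] by (auto simp: Q_def)
    qed
    ultimately have "AE t in lebesgue. \<forall>p\<in>Q. t \<in> {fst p..snd p} \<longrightarrow> l i t = 0"
      by (simp only: AE_ball_countable) blast
    then have "AE t in lebesgue_on {0<..<T}. \<Lambda> t i \<ge> 0 \<and> \<Lambda> t i * (X (i + 1) t - X i t - 2 * r) = 0"
      unfolding AE_restrict_space_iff[of "{0<..<T}" lebesgue, simplified]
    proof eventually_elim
      case (elim t)
      show ?case
      proof
        assume t: "0 < t \<and> t < T"
        have "l i t = 0" if g: "X (i + 1) t - X i t \<noteq> 2 * r"
        proof -
          have "X (i + 1) t - X i t > 2 * r" using gap[OF i, of t] t g by auto
          then obtain a b where "(a, b) \<in> Q" "a < t" "t < b" using flat[OF i, of t] t by (auto simp: Q_def)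
          then show ?thesis using elim by force
        qed
        then show "\<Lambda> t i \<ge> 0 \<and> \<Lambda> t i * (X (i + 1) t - X i t - 2 * r) = 0"
          using l0[OF iN, of t] by (auto simp: \<Lambda>_def)
      qed
    qed
    then show ?thesis by (simp only: AE_lebesgue_on_Icc_iff_Ioo)
  qed
  have "is_solution T \<phi> r N x0 (\<lambda>t i. X i t) \<Lambda>"
    unfolding is_solution_def
  proof (intro conjI ballI)
    show "(\<lambda>t i. X i t) \<in> H1_vec T {1..N}" using weak unfolding H1_vec_def H1_def by blast
    have "(\<lambda>t. \<Lambda> t i) \<in> L2 T" if "i \<le> N" for i
    proof (rule L2_bounded)
      show "(\<lambda>t. \<Lambda> t i) \<in> borel_measurable (lebesgue_on {0<..<T})"
        unfolding \<Lambda>_def using lmes[OF that] by simp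
      show "\<bar>\<Lambda> t i\<bar> \<le> C / real N" for t
        using l0[OF that, of t] lC[OF that, of t] by (simp add: \<Lambda>_def divide_right_mono)
    qed
    then show "\<Lambda> \<in> L2_vec T {0..N}" by (simp add: L2_vec_def)
    show "\<exists>v. has_weak_deriv T (\<lambda>t. X i t) v \<and> (AE t in lebesgue_on {0..T}.
           v t = - deriv \<phi> (X i t) - real N * (\<Lambda> t i - \<Lambda> t (i - 1)))" if "i \<in> {1..N}" for i
      using weak[OF that] by (intro exI[of _ "V i"]) (simp add: V_def)
    show "AE t in lebesgue_on {0..T}. \<Lambda> t 0 = 0 \<and> \<Lambda> t N = 0" by (simp add: \<Lambda>_def lN)
  qed (use X0 gap compl Xc in auto)
  then show ?thesis by blast
qed

section \<open>Uniqueness\<close>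

text \<open>Integration by parts of \<open>u\<close>, cut off at \<open>t\<close>, against itself.
  It replaces the chain rule for the square of a function that has only a weak derivative.\<close>

lemma primitive_energy:
  assumes u: "integrable (lebesgue_on {0<..<T}) u"
  shows "(primitive T u t)\<^sup>2 = 2 * primitive T (\<lambda>s. primitive T u s * u s) t"
proof -
  define v where "v s = indicator {..t} s * u s" for s
  have v: "integrable (lebesgue_on {0<..<T}) v"
    unfolding v_def by (rule integrable_indicator_mult[OF u]) auto
  have pv: "primitive T v s * v s = indicator {..t} s * (primitive T u s * u s)" for s
  proof (cases "s \<le> t")
    case True
    then have "primitive T v s = primitive T u s"
      unfolding primitive_def by (intro Bochner_Integration.integral_cong) (auto simp: v_def indicator_def)
    with True show ?thesis by (simp add: v_def)
  qed (simp add: v_def)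
  have "(LINT s|lebesgue_on {0<..<T}. primitive T v s * v s) + (LINT s|lebesgue_on {0<..<T}. v s * primitive T v s)
     = (LINT s|lebesgue_on {0<..<T}. v s) * (LINT s|lebesgue_on {0<..<T}. v s)"
    unfolding primitive_def by (rule integral_by_parts_indefinite(3)[OF _ v v]) simp
  moreover have "(LINT s|lebesgue_on {0<..<T}. v s) = primitive T u t"
    by (simp add: primitive_def v_def)
  moreover have "(LINT s|lebesgue_on {0<..<T}. primitive T v s * v s) = primitive T (\<lambda>s. primitive T u s * u s) t"
    unfolding pv by (simp add: primitive_def)
  ultimately show ?thesis by (simp add: power2_eq_square mult.commute)
qed

lemma primitive_mono:
  assumes "integrable (lebesgue_on {0<..<T}) u" "integrable (lebesgue_on {0<..<T}) v"
    and "AE s in lebesgue_on {0<..<T}. u s \<le> v s"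
  shows "primitive T u t \<le> primitive T v t"
  unfolding primitive_def
proof (rule integral_mono_AE)
  show "AE s in lebesgue_on {0<..<T}. indicator {..t} s * u s \<le> indicator {..t} s * v s"
    using assms(3) by eventually_elim (auto simp: indicator_def)
qed (use assms in \<open>auto intro!: integrable_indicator_mult\<close>)

lemma primitive_sum:
  assumes "\<And>i. i \<in> I \<Longrightarrow> integrable (lebesgue_on {0<..<T}) (u i)"
  shows "primitive T (\<lambda>s. \<Sum>i\<in>I. u i s) t = (\<Sum>i\<in>I. primitive T (u i) t)"
  unfolding primitive_def sum_distrib_left
  by (rule Bochner_Integration.integral_sum) (use assms in \<open>auto intro!: integrable_indicator_mult\<close>)

text \<open>The integral \<open>J\<close> of \<open>E\<close> is differentiable even if
  \<open>E\<close> is not, and the hypothesis makes \<open>exp (- K * t) * J t\<close> nonincreasing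
  from the value 0.\<close>

lemma gronwall_zero:
  fixes E :: "real \<Rightarrow> real"
  assumes cont: "continuous_on {0..T} E" and E0: "\<And>t. t \<in> {0..T} \<Longrightarrow> 0 \<le> E t"
    and E: "\<And>t. t \<in> {0..T} \<Longrightarrow> E t \<le> K * integral {0..t} E" and K: "0 \<le> K" and t: "t \<in> {0..T}"
  shows "E t = 0"
proof -
  define J where "J t = integral {0..t} E" for t
  have Jd: "(J has_real_derivative E x) (at x within {0..T})" if "x \<in> {0..T}" for x
    unfolding J_def by (rule integral_has_real_derivative[OF cont that])
  have Jc: "continuous_on {0..T} J" unfolding J_def
    by (intro indefinite_integral_continuous_1 integrable_continuous_real cont)
  have "exp (- K * t) * J t \<le> exp (- K * 0) * J 0"
  proof (rule DERIV_nonpos_imp_decreasing_open[where f="\<lambda>t. exp (- K * t) * J t"])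
    fix x assume x: "0 < x" "x < t"
    then have "(J has_real_derivative E x) (at x)"
      using Jd[of x] at_within_interior[of x "{0..T}"] t by simp
    then have "((\<lambda>t. exp (- K * t) * J t) has_real_derivative exp (- K * x) * (E x - K * J x)) (at x)"
      by (auto intro!: derivative_eq_intros simp: algebra_simps)
    moreover have "exp (- K * x) * (E x - K * J x) \<le> 0"
      using E[of x] x t by (intro mult_nonneg_nonpos) (auto simp: J_def)
    ultimately show "\<exists>y. ((\<lambda>t. exp (- K * t) * J t) has_real_derivative y) (at x) \<and> y \<le> 0" by blast
  next
    show "continuous_on {0..t} (\<lambda>t. exp (- K * t) * J t)"
      using t by (intro continuous_intros continuous_on_subset[OF Jc]) auto
  qed (use t in auto)
  then have "J t \<le> 0" by (simp add: J_def mult_le_0_iff)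
  then have "K * J t \<le> 0" using K by (simp add: mult_nonneg_nonpos)
  then show ?thesis using E[OF t] E0[OF t] by (simp add: J_def)
qed

text \<open>Abel summation that moves the difference from the multipliers to the positions. The
  out-of-range value \<open>d (n + 1)\<close> is harmless in the application, being multiplied by
  the last multiplier, which is 0.\<close>

lemma summation_by_parts_pressure:
  fixes d \<mu> :: "nat \<Rightarrow> real"
  shows "(\<Sum>i=1..n. d i * (\<mu> i - \<mu> (i - 1))) = d (n + 1) * \<mu> n - d 1 * \<mu> 0 - (\<Sum>i=1..n. \<mu> i * (d (i + 1) - d i))"
  by (induction n) (auto simp: algebra_simps)

text \<open>The reaction forces are monotone: each of them vanishes unless the corresponding gap is closed.\<close>

lemma dissipation_inequality:
  fixes g :: "real \<Rightarrow> real" and X Y v w l m :: "nat \<Rightarrow> real"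
  assumes lip: "\<And>x y. \<bar>g x - g y\<bar> \<le> K * \<bar>x - y\<bar>"
    and v: "\<And>i. i \<in> {1..N} \<Longrightarrow> v i = - g (X i) - real N * (l i - l (i - 1))"
    and w: "\<And>i. i \<in> {1..N} \<Longrightarrow> w i = - g (Y i) - real N * (m i - m (i - 1))"
    and l: "\<And>i. i \<in> {1..<N} \<Longrightarrow> 0 \<le> l i \<and> l i * (X (i + 1) - X i - c) = 0"
    and m: "\<And>i. i \<in> {1..<N} \<Longrightarrow> 0 \<le> m i \<and> m i * (Y (i + 1) - Y i - c) = 0"
    and gaps: "\<And>i. i \<in> {1..<N} \<Longrightarrow> X (i + 1) - X i \<ge> c" "\<And>i. i \<in> {1..<N} \<Longrightarrow> Y (i + 1) - Y i \<ge> c"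
    and bd: "l 0 = 0" "m 0 = 0" "l N = 0" "m N = 0"
  shows "(\<Sum>i=1..N. (X i - Y i) * (v i - w i)) \<le> K * (\<Sum>i=1..N. (X i - Y i)\<^sup>2)"
proof -
  define d where "d i = X i - Y i" for i
  define \<mu> where "\<mu> i = l i - m i" for i
  have "\<mu> i * (d (i + 1) - d i) \<le> 0" if i: "i \<in> {1..N}" for i
  proof (cases "i = N")
    case False
    then have i': "i \<in> {1..<N}" using i by auto
    \<comment> \<open>The first two products vanish by complementarity; the two mixed ones pair a
      nonnegative multiplier with a nonnegative gap excess of the other solution.\<close>
    have "\<mu> i * (d (i + 1) - d i) = l i * (X (i + 1) - X i - c) + m i * (Y (i + 1) - Y i - c)
      - l i * (Y (i + 1) - Y i - c) - m i * (X (i + 1) - X i - c)"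
      by (simp add: \<mu>_def d_def algebra_simps)
    moreover have "0 \<le> l i * (Y (i + 1) - Y i - c)" "0 \<le> m i * (X (i + 1) - X i - c)"
      using l[OF i'] m[OF i'] gaps[OF i'] by auto
    ultimately show ?thesis using l[OF i'] m[OF i'] by linarith
  qed (simp add: \<mu>_def bd)
  then have "(\<Sum>i=1..N. \<mu> i * (d (i + 1) - d i)) \<le> 0" by (rule sum_nonpos)
  then have pos: "0 \<le> (\<Sum>i=1..N. d i * (\<mu> i - \<mu> (i - 1)))"
    by (subst summation_by_parts_pressure) (simp add: \<mu>_def bd)
  have "(\<Sum>i=1..N. (X i - Y i) * (v i - w i))
    = (\<Sum>i=1..N. - (d i * (g (X i) - g (Y i))) - real N * (d i * (\<mu> i - \<mu> (i - 1))))"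
    by (rule sum.cong) (auto simp: v w d_def \<mu>_def algebra_simps)
  also have "\<dots> = (\<Sum>i=1..N. - (d i * (g (X i) - g (Y i)))) - real N * (\<Sum>i=1..N. d i * (\<mu> i - \<mu> (i - 1)))"
    by (simp add: sum_subtractf sum_distrib_left)
  also have "\<dots> \<le> (\<Sum>i=1..N. - (d i * (g (X i) - g (Y i))))" using pos by simp
  also have "\<dots> \<le> (\<Sum>i=1..N. K * (d i)\<^sup>2)"
  proof (rule sum_mono)
    fix i
    have "- (d i * (g (X i) - g (Y i))) \<le> \<bar>d i\<bar> * \<bar>g (X i) - g (Y i)\<bar>"
      using abs_ge_minus_self[of "d i * (g (X i) - g (Y i))"] by (simp add: abs_mult)
    also have "\<dots> \<le> \<bar>d i\<bar> * (K * \<bar>d i\<bar>)" unfolding d_def by (intro mult_left_mono lip) auto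
    also have "\<dots> = K * (d i)\<^sup>2" by (simp add: power2_eq_square)
    finally show "- (d i * (g (X i) - g (Y i))) \<le> K * (d i)\<^sup>2" .
  qed
  finally show ?thesis by (simp add: d_def sum_distrib_left)
qed

lemma solution_velocity:
  assumes "is_solution T \<phi> r N x0 X \<Lambda>"
  obtains v where "\<And>i. i \<in> {1..N} \<Longrightarrow> has_weak_deriv T (\<lambda>t. X t i) (v i)"
    "\<And>i. i \<in> {1..N} \<Longrightarrow> AE t in lebesgue_on {0..T}. v i t = - deriv \<phi> (X t i) - real N * (\<Lambda> t i - \<Lambda> t (i - 1))"
proof -
  have "\<forall>i\<in>{1..N}. \<exists>v. has_weak_deriv T (\<lambda>t. X t i) v \<and> (AE t in lebesgue_on {0..T}.
      v t = - deriv \<phi> (X t i) - real N * (\<Lambda> t i - \<Lambda> t (i - 1)))"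
    using assms unfolding is_solution_def by blast
  then obtain v where v: "\<forall>i\<in>{1..N}. has_weak_deriv T (\<lambda>t. X t i) (v i) \<and> (AE t in lebesgue_on {0..T}.
      v i t = - deriv \<phi> (X t i) - real N * (\<Lambda> t i - \<Lambda> t (i - 1)))"
    by (rule bchoice[THEN exE])
  show ?thesis
    by (rule that[of v]) (erule bspec[OF v, THEN conjunct1] bspec[OF v, THEN conjunct2])+
qed

lemma solution_unique:
  assumes T: "T > 0" and lip: "\<And>x y. \<bar>deriv \<phi> x - deriv \<phi> y\<bar> \<le> K * \<bar>x - y\<bar>"
    and sX: "is_solution T \<phi> r N x0 X \<Lambda>" and sY: "is_solution T \<phi> r N x0 Y M"
  shows "\<And>i t. i \<in> {1..N} \<Longrightarrow> t \<in> {0..T} \<Longrightarrow> Y t i = X t i"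
    and "\<And>i. i \<in> {0..N} \<Longrightarrow> AE t in lebesgue_on {0..T}. M t i = \<Lambda> t i"
proof -
  have K: "K \<ge> 0" using lip[of 1 0] by simp
  have Xc: "continuous_on {0..T} (\<lambda>t. X t i)" and Yc: "continuous_on {0..T} (\<lambda>t. Y t i)" if "i \<in> {1..N}" for i
    using sX sY that by (auto simp: is_solution_def)
  have init: "X 0 i = x0 i" "Y 0 i = x0 i" if "i \<in> {1..N}" for i
    using sX sY that by (auto simp: is_solution_def)
  obtain v where v: "\<And>i. i \<in> {1..N} \<Longrightarrow> has_weak_deriv T (\<lambda>t. X t i) (v i)"
    and vAE: "\<And>i. i \<in> {1..N} \<Longrightarrow> AE t in lebesgue_on {0..T}. v i t = - deriv \<phi> (X t i) - real N * (\<Lambda> t i - \<Lambda> t (i - 1))"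
    using solution_velocity[OF sX] by blast
  obtain w where w: "\<And>i. i \<in> {1..N} \<Longrightarrow> has_weak_deriv T (\<lambda>t. Y t i) (w i)"
    and wAE: "\<And>i. i \<in> {1..N} \<Longrightarrow> AE t in lebesgue_on {0..T}. w i t = - deriv \<phi> (Y t i) - real N * (M t i - M t (i - 1))"
    using solution_velocity[OF sY] by blast
  have vL2: "v i \<in> L2 T" and wL2: "w i \<in> L2 T" if "i \<in> {1..N}" for i
    using v[OF that] w[OF that] by (auto simp: has_weak_deriv_def)
  define u where "u i t = v i t - w i t" for i t
  have u: "integrable (lebesgue_on {0<..<T}) (u i)" if "i \<in> {1..N}" for i
    unfolding u_def by (intro L2_imp_integrable L2_diff vL2 wL2 that)
  define d where "d i t = X t i - Y t i" for i t
  have dc: "continuous_on {0..T} (d i)" if "i \<in> {1..N}" for i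
    unfolding d_def by (intro continuous_intros Xc Yc that)
  have d: "d i t = primitive T (u i) t" if i: "i \<in> {1..N}" and t: "t \<in> {0..T}" for i t
  proof -
    have "primitive T (u i) t = primitive T (v i) t - primitive T (w i) t"
      using L2_imp_integrable[OF vL2[OF i]] L2_imp_integrable[OF wL2[OF i]]
      by (simp add: primitive_def u_def right_diff_distrib integrable_indicator_mult)
    then show ?thesis
      using weak_deriv_imp_primitive[OF T v[OF i] Xc[OF i] t] weak_deriv_imp_primitive[OF T w[OF i] Yc[OF i] t]
        init[OF i] by (simp add: d_def)
  qed
  define E where "E t = (\<Sum>i=1..N. (d i t)\<^sup>2)" for t
  have Ec: "continuous_on {0..T} E" unfolding E_def by (intro continuous_intros dc)
  have Ei: "integrable (lebesgue_on {0<..<T}) E" by (intro L2_imp_integrable L2_continuous Ec)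
  have ineq: "AE t in lebesgue_on {0<..<T}. (\<Sum>i=1..N. d i t * u i t) \<le> K * E t"
  proof -
    have "AE t in lebesgue_on {0..T}. \<forall>i\<in>{1..N}. v i t = - deriv \<phi> (X t i) - real N * (\<Lambda> t i - \<Lambda> t (i - 1))"
      "AE t in lebesgue_on {0..T}. \<forall>i\<in>{1..N}. w i t = - deriv \<phi> (Y t i) - real N * (M t i - M t (i - 1))"
      unfolding AE_ball_countable[OF countable_finite[OF finite_atLeastAtMost]] using vAE wAE by blast+
    moreover have "AE t in lebesgue_on {0..T}. \<forall>i\<in>{1..<N}. \<Lambda> t i \<ge> 0 \<and> \<Lambda> t i * (X t (i + 1) - X t i - 2 * r) = 0"
      "AE t in lebesgue_on {0..T}. \<forall>i\<in>{1..<N}. M t i \<ge> 0 \<and> M t i * (Y t (i + 1) - Y t i - 2 * r) = 0"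
      unfolding AE_ball_countable[OF countable_finite[OF finite_atLeastLessThan]]
      using sX sY unfolding is_solution_def by blast+
    moreover have "AE t in lebesgue_on {0..T}. \<Lambda> t 0 = 0 \<and> \<Lambda> t N = 0" "AE t in lebesgue_on {0..T}. M t 0 = 0 \<and> M t N = 0"
      using sX sY unfolding is_solution_def by blast+
    moreover have "AE t in lebesgue_on {0..T}. t \<in> {0..T}" by (rule AE_I2) simp
    ultimately have "AE t in lebesgue_on {0..T}. (\<Sum>i=1..N. d i t * u i t) \<le> K * E t"
    proof eventually_elim
      case (elim t)
      show ?case unfolding d_def u_def E_def
      proof (rule dissipation_inequality[where g="deriv \<phi>" and l="\<Lambda> t" and m="M t" and c="2 * r", OF lip])
        show "X t (i + 1) - X t i \<ge> 2 * r" "Y t (i + 1) - Y t i \<ge> 2 * r" if "i \<in> {1..<N}" for i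
          using sX sY that elim by (auto simp: is_solution_def)
      qed (use elim in auto)
    qed
    then show ?thesis by (simp only: AE_lebesgue_on_Icc_iff_Ioo)
  qed
  \<comment> \<open>The energy identity applied to each component and summed, so that the pointwise
    dissipation inequality can be integrated in time.\<close>
  have EK: "E t \<le> (2 * K) * integral {0..t} E" if t: "t \<in> {0..T}" for t
  proof -
    have pdu: "integrable (lebesgue_on {0<..<T}) (\<lambda>s. primitive T (u i) s * u i s)" if "i \<in> {1..N}" for i
      unfolding primitive_def by (rule integral_by_parts_indefinite(1)[OF _ u u]) (use that in auto)
    have du: "integrable (lebesgue_on {0<..<T}) (\<lambda>s. d i s * u i s)" if "i \<in> {1..N}" for i
      using pdu[OF that] by (rule Bochner_Integration.integrable_cong[THEN iffD1, rotated 2]) (use d that in auto)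
    have "E t = (\<Sum>i=1..N. 2 * primitive T (\<lambda>s. primitive T (u i) s * u i s) t)"
      unfolding E_def by (rule sum.cong) (use d t u in \<open>auto simp: primitive_energy\<close>)
    also have "\<dots> = (\<Sum>i=1..N. 2 * primitive T (\<lambda>s. d i s * u i s) t)"
    proof (rule sum.cong)
      fix i assume i: "i \<in> {1..N}"
      show "2 * primitive T (\<lambda>s. primitive T (u i) s * u i s) t = 2 * primitive T (\<lambda>s. d i s * u i s) t"
        unfolding primitive_def[of T "\<lambda>s. _ s * _ s"]
        by (intro arg_cong[where f="\<lambda>x. 2 * x"] Bochner_Integration.integral_cong) (use d i in auto)
    qed simp
    also have "\<dots> = 2 * primitive T (\<lambda>s. \<Sum>i=1..N. d i s * u i s) t"
      by (subst primitive_sum[OF du]) (simp_all add: sum_distrib_left)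
    also have "\<dots> \<le> 2 * primitive T (\<lambda>s. K * E s) t"
    proof (rule mult_left_mono[OF primitive_mono[OF _ _ ineq]])
      show "integrable (lebesgue_on {0<..<T}) (\<lambda>s. \<Sum>i=1..N. d i s * u i s)"
        by (intro Bochner_Integration.integrable_sum du)
    qed (use Ei in auto)
    also have "primitive T (\<lambda>s. K * E s) t = K * primitive T E t"
      by (simp add: primitive_def mult.left_commute)
    also have "primitive T E t = integral {0..t} E" by (rule primitive_eq_integral(2)[OF Ei t])
    finally show ?thesis by simp
  qed
  have E0: "E t = 0" if "t \<in> {0..T}" for t
    by (rule gronwall_zero[OF Ec _ EK _ that]) (use K in \<open>auto simp: E_def sum_nonneg\<close>)
  show eq: "Y t i = X t i" if i: "i \<in> {1..N}" and t: "t \<in> {0..T}" for i t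
  proof -
    have "\<forall>i\<in>{1..N}. (d i t)\<^sup>2 = 0"
      using E0[OF t] unfolding E_def by (subst (asm) sum_nonneg_eq_0_iff) auto
    then show ?thesis using i by (simp add: d_def)
  qed
  show "AE t in lebesgue_on {0..T}. M t i = \<Lambda> t i" if "i \<in> {0..N}" for i
    using that
  proof (induction i)
    case 0
    have "AE t in lebesgue_on {0..T}. \<Lambda> t 0 = 0 \<and> \<Lambda> t N = 0" "AE t in lebesgue_on {0..T}. M t 0 = 0 \<and> M t N = 0"
      using sX sY unfolding is_solution_def by blast+
    then show ?case by eventually_elim simp
  next
    case (Suc i)
    then have i: "Suc i \<in> {1..N}" by auto
    have "AE t in lebesgue_on {0..T}. v (Suc i) t = w (Suc i) t"
      unfolding AE_lebesgue_on_Icc_iff_Ioo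
      by (rule weak_deriv_unique[OF T v[OF i] w[OF i] Xc[OF i]]) (use eq i in auto)
    moreover have "AE t in lebesgue_on {0..T}. t \<in> {0..T}" by (rule AE_I2) simp
    moreover have "AE t in lebesgue_on {0..T}. M t i = \<Lambda> t i" using Suc by simp
    ultimately show ?case
      using vAE[OF i] wAE[OF i]
    proof eventually_elim
      case (elim t)
      \<comment> \<open>Equal positions and velocities give equal force differences; with the
        multipliers of index \<open>i\<close> already identified, the next ones agree because
        \<open>Suc i \<le> N\<close> makes \<open>N\<close> nonzero.\<close>
      then have "real N * (\<Lambda> t (Suc i) - \<Lambda> t i) = real N * (M t (Suc i) - \<Lambda> t i)"
        using eq[OF i elim(2)] by simp
      then show ?case using i by simp
    qed
  qed
qed

theorem proposition1p4:
  fixes T c0 r :: real and \<phi> :: "real \<Rightarrow> real" and N :: nat and x0 :: "nat \<Rightarrow> real"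
  assumes "T > 0"
    and "\<And>x. \<phi> differentiable (at x)"
    and "\<And>x. deriv \<phi> differentiable (at x)"
    and "continuous_on UNIV (deriv (deriv \<phi>))"
    and "bdd_above (range (\<lambda>x. \<bar>deriv (deriv \<phi>) x\<bar>))"
    and "c0 > 0"
    and "\<And>x. \<phi> x \<ge> c0 * (1 + \<bar>x\<bar>\<^sup>2)"
    and "r > 0"
    and "\<And>i. i \<in> {1..<N} \<Longrightarrow> x0 (i + 1) - x0 i \<ge> 2 * r"
  shows "\<exists>X \<Lambda>. is_solution T \<phi> r N x0 X \<Lambda> \<and>
           (\<forall>Y M. is_solution T \<phi> r N x0 Y M \<longrightarrow>
              (\<forall>i\<in>{1..N}. \<forall>t\<in>{0..T}. Y t i = X t i) \<and>
              (\<forall>i\<in>{0..N}. AE t in lebesgue_on {0..T}. M t i = \<Lambda> t i))"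
proof -
  obtain K where K: "\<And>x. \<bar>deriv (deriv \<phi>) x\<bar> \<le> K"
    using assms(5) by (auto simp: bdd_above_def)
  have "(deriv \<phi> has_real_derivative deriv (deriv \<phi>) x) (at x within UNIV)" for x
    using assms(3)[of x] by (simp add: DERIV_deriv_iff_real_differentiable)
  then have lip: "\<bar>deriv \<phi> x - deriv \<phi> y\<bar> \<le> K * \<bar>x - y\<bar>" for x y
    using field_differentiable_bound[of UNIV "deriv \<phi>" "deriv (deriv \<phi>)" K x y] K by simp
  obtain X \<Lambda> where sol: "is_solution T \<phi> r N x0 X \<Lambda>"
    using solution_exists[where \<phi>=\<phi> and ?x0.0=x0, OF assms(1) less_imp_le[OF assms(8)] lip assms(9)] by blast
  show ?thesis
    using sol solution_unique[OF assms(1) lip sol] by blast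
qed

end
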